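(* Let $H$ be a separable real Hilbert space and let $X$ be an $H$-valued random variable satisfying assumptions (A1) and (A2) stated in the context, with geometric median $m$. Let $(\gamma_n)_{n\in\mathbb{N}}$ be a sequence of positive real numbers such that $$\sum_{n\ge 1}\gamma_n=\infty,\qquad \sum_{n\ge 1}\gamma_n^2<\infty,$$ and let $(Z_n)_{n\ge 0}$ be the stochastic gradient algorithm defined in the context with steps $(\gamma_n)$. Then $$\lim_{n\to\infty}\|Z_n-m\|=0\quad\text{almost surely.}$$
   Context: $\langle\cdot,\cdot\rangle$ and $\|\cdot\|$ denote the inner product and norm of $H$. Geometric median: $m=\arg\min_{u\in H}\mathbb{E}\left[\|X-u\|-\|X\|\right]$ (no moment of $X$ is assumed; under (A1) the minimizer is unique). (A1) $X$ is not concentrated on a straight line: for every $v\in H$ there is $w\in H$ with $\langle v,w\rangle=0$ and $\mathrm{Var}(\langle w,X\rangle)>0$. (Since no moment is assumed, the variance may be $+\infty$; the condition means that $\langle w,X\rangle$ is not almost surely constant.) (A2) The law of $X$ is a mixture $\mu_X=\lambda\mu_c+(1-\lambda)\mu_d$, $\lambda\in[0,1]$, of two probability measures such that: (i) if $Y$ has law $\mu_c$, then for every $A>0$ there is $C_A\in[0,\infty)$ such that $\mathbb{E}\left[\|Y-\alpha\|^{-1}\right]\le C_A$ for all $\alpha\in H$ with $\|\alpha\|\le A$; (ii) $\mu_d=\sum_i p_i\delta_{x_i}$ is a discrete measure, with support $D$, and $m\notin D$. Algorithm: $X_1,X_2,\dots$ are independent copies of $X$. The starting point $Z_0$ is either deterministic,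 or random, bounded and independent of $(X_n)_{n\ge1}$ (e.g. $Z_0=X_0\mathbf{1}_{\{\|X_0\|\le M\}}$ with $X_0$ an independent copy of $X$ and $M>0$ a constant). For $n\ge 0$, $$Z_{n+1}=Z_n+\gamma_n\frac{X_{n+1}-Z_n}{\|X_{n+1}-Z_n\|},$$ with the convention $Z_{n+1}=Z_n$ if $X_{n+1}=Z_n$. *)

theory Defs
  imports "HOL-Probability.Probability"
begin

text \<open>
  Variance with values in \<open>[0, \<infinity>]\<close>. A variable without a mean has variance \<open>\<infinity>\<close>; the library's
  real-valued variance would return a junk value for variables without a second moment.
\<close>

definition ext_variance :: "'w measure \<Rightarrow> ('w \<Rightarrow> real) \<Rightarrow> ennreal" where
  "ext_variance N Y =
     (if integrable N Y
      then (\<integral>\<^sup>+ \<omega>. ennreal ((Y \<omega> - integral\<^sup>L N Y)\<^sup>2) \<partial>N)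
      else \<infinity>)"

lemma ext_variance_pos_iff:
  assumes "prob_space N" and Y: "Y \<in> borel_measurable N"
  shows "0 < ext_variance N Y \<longleftrightarrow> \<not> (\<exists>c. AE \<omega> in N. Y \<omega> = c)"
proof -
  interpret prob_space N by fact
  have "ext_variance N Y = 0 \<longleftrightarrow> (\<exists>c. AE \<omega> in N. Y \<omega> = c)"
  proof
    assume 0: "ext_variance N Y = 0"
    have "integrable N Y"
      using 0 by (auto simp: ext_variance_def split: if_splits)
    then have "(\<integral>\<^sup>+ \<omega>. ennreal ((Y \<omega> - integral\<^sup>L N Y)\<^sup>2) \<partial>N) = 0"
      using 0 by (simp add: ext_variance_def)
    then have "AE \<omega> in N. ennreal ((Y \<omega> - integral\<^sup>L N Y)\<^sup>2) = 0"
      using Y by (subst (asm) nn_integral_0_iff_AE) auto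
    then have "AE \<omega> in N. Y \<omega> = integral\<^sup>L N Y"
      by eventually_elim (simp add: ennreal_eq_0_iff)
    then show "\<exists>c. AE \<omega> in N. Y \<omega> = c" by blast
  next
    assume "\<exists>c. AE \<omega> in N. Y \<omega> = c"
    then obtain c where c: "AE \<omega> in N. Y \<omega> = c" by blast
    have int: "integrable N Y"
      using integrable_cong_AE[of Y N "\<lambda>_. c"] Y c by simp
    have mean: "integral\<^sup>L N Y = c"
      using integral_cong_AE[of Y N "\<lambda>_. c"] Y c by (simp add: prob_space)
    have "AE \<omega> in N. ennreal ((Y \<omega> - integral\<^sup>L N Y)\<^sup>2) = 0"
      using c by eventually_elim (simp add: mean)
    then have "(\<integral>\<^sup>+ \<omega>. ennreal ((Y \<omega> - integral\<^sup>L N Y)\<^sup>2) \<partial>N) = 0"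
      using Y by (subst nn_integral_0_iff_AE) auto
    then show "ext_variance N Y = 0"
      using int by (simp add: ext_variance_def)
  qed
  then show ?thesis by (simp add: zero_less_iff_neq_zero)
qed

definition is_geometric_median ::
    "'w measure \<Rightarrow> ('w \<Rightarrow> 'a::{real_inner, banach, second_countable_topology}) \<Rightarrow> 'a \<Rightarrow> bool" where
  "is_geometric_median N X m \<longleftrightarrow>
     is_arg_min (\<lambda>u. \<integral>\<omega>. (norm (X \<omega> - u) - norm (X \<omega>)) \<partial>N) (\<lambda>_. True) m"

definition not_concentrated_on_line ::
    "'w measure \<Rightarrow> ('w \<Rightarrow> 'a::{real_inner, banach, second_countable_topology}) \<Rightarrow> bool" where
  "not_concentrated_on_line N X \<longleftrightarrow>
     (\<forall>v. \<exists>w. v \<bullet> w = 0 \<and> 0 < ext_variance N (\<lambda>\<omega>. w \<bullet> X \<omega>))"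

text \<open>
  The reciprocal of the distance is taken in \<^typ>\<open>ennreal\<close>, where \<open>inverse 0 = \<infinity>\<close>, so that an atom
  of \<open>\<mu>\<^sub>c\<close> at \<open>\<alpha>\<close> makes the expectation infinite.
\<close>

definition bounded_inverse_distance_moment ::
    "'a::{real_inner, banach, second_countable_topology} measure \<Rightarrow> bool" where
  "bounded_inverse_distance_moment \<mu>\<^sub>c \<longleftrightarrow>
     (\<forall>A>0::real. \<exists>C\<ge>0::real. \<forall>\<alpha>. norm \<alpha> \<le> A \<longrightarrow>
        (\<integral>\<^sup>+ y. inverse (ennreal (norm (y - \<alpha>))) \<partial>\<mu>\<^sub>c) \<le> ennreal C)"

text \<open>
  The discrete part \<open>\<Sum>\<^sub>i p\<^sub>i \<delta>\<^bsub>x\<^sub>i\<^esub>\<close> is a probability mass function; its support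
  \<open>D\<close> is read as the set of the \<open>x\<^sub>i\<close> with \<open>p\<^sub>i > 0\<close>, not as the closure of that set.
\<close>

definition mixture_condition ::
    "'w measure \<Rightarrow> ('w \<Rightarrow> 'a::{real_inner, banach, second_countable_topology}) \<Rightarrow> 'a \<Rightarrow> bool" where
  "mixture_condition N X m \<longleftrightarrow>
     (\<exists>l \<mu>\<^sub>c \<mu>\<^sub>d. 0 \<le> l \<and> l \<le> 1 \<and>
        prob_space \<mu>\<^sub>c \<and> sets \<mu>\<^sub>c = sets borel \<and>
        (\<forall>B\<in>sets borel. measure (distr N borel X) B
            = l * measure \<mu>\<^sub>c B + (1 - l) * measure (measure_pmf \<mu>\<^sub>d) B) \<and>
        bounded_inverse_distance_moment \<mu>\<^sub>c \<and>
        m \<notin> set_pmf \<mu>\<^sub>d)"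

text \<open>
  Since \<open>inverse 0 = 0\<close> in \<^typ>\<open>real\<close>, the step leaves the iterate unchanged when it equals the
  new sample. The samples are \<open>X 1, X 2, \<dots>\<close>; \<open>X 0\<close> is never used.
\<close>

primrec sg_iterate ::
    "(nat \<Rightarrow> real) \<Rightarrow> ('w \<Rightarrow> 'a::{real_inner, banach, second_countable_topology}) \<Rightarrow>
     (nat \<Rightarrow> 'w \<Rightarrow> 'a) \<Rightarrow> nat \<Rightarrow> 'w \<Rightarrow> 'a" where
  "sg_iterate \<gamma> Z\<^sub>0 X 0 \<omega> = Z\<^sub>0 \<omega>"
| "sg_iterate \<gamma> Z\<^sub>0 X (Suc n) \<omega> = sg_iterate \<gamma> Z\<^sub>0 X n \<omega> +
     \<gamma> n *\<^sub>R ((X (Suc n) \<omega> - sg_iterate \<gamma> Z\<^sub>0 X n \<omega>) /\<^sub>R norm (X (Suc n) \<omega> - sg_iterate \<gamma> Z\<^sub>0 X n \<omega>))"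

text \<open>
  A deterministic starting point is the special case of a constant \<open>Z\<^sub>0\<close>, which is bounded and
  independent of everything. Independence of the samples is independence of the generated
  \<open>\<sigma>\<close>-algebras (the library's \<open>indep_var\<close> only relates variables of equal type).
\<close>

definition admissible_start ::
    "'w measure \<Rightarrow> (nat \<Rightarrow> 'w \<Rightarrow> 'a::{real_inner, banach, second_countable_topology}) \<Rightarrow>
     ('w \<Rightarrow> 'a) \<Rightarrow> bool" where
  "admissible_start M X Z\<^sub>0 \<longleftrightarrow>
     (\<exists>K. AE \<omega> in M. norm (Z\<^sub>0 \<omega>) \<le> K) \<and>
     Z\<^sub>0 \<in> borel_measurable M \<and>
     prob_space.indep_set M
       (sets (vimage_algebra (space M) Z\<^sub>0 borel))
       (sets (vimage_algebra (space M) (\<lambda>\<omega>. \<lambda>n\<in>{1..}. X n \<omega>) (Pi\<^sub>M {1..} (\<lambda>_. borel))))"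

definition independent_copies ::
    "'w measure \<Rightarrow> (nat \<Rightarrow> 'w \<Rightarrow> 'a::{real_inner, banach, second_countable_topology}) \<Rightarrow>
     'v measure \<Rightarrow> ('v \<Rightarrow> 'a) \<Rightarrow> bool" where
  "independent_copies M Xs N X \<longleftrightarrow>
     prob_space.indep_vars M (\<lambda>_. borel) Xs {1..} \<and>
     (\<forall>n\<ge>1. distr M borel (Xs n) = distr N borel X)"

end

theory Submission
  imports Defs
begin

text \<open>
  Let \<open>\<Delta> z = E(\<parallel>X - z\<parallel> - \<parallel>X - m\<parallel>)\<close>. Since \<open>sgn (X - z)\<close> has norm at most 1, Cauchy--Schwarz gives
  \<open>\<langle>sgn (X - z), z - m\<rangle> \<le> \<parallel>X - m\<parallel> - \<parallel>X - z\<parallel>\<close>, so that the squared distance to \<open>m\<close> decreases in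
  conditional mean by at least \<open>2 \<gamma>\<^sub>n \<Delta>(Z\<^sub>n) - \<gamma>\<^sub>n\<^sup>2\<close> at each step.

  In infinite dimension, \<open>\<Delta>\<close> is bounded away from 0 outside every ball about \<open>m\<close> for the following
  reason. Convexity at the midpoint of \<open>m\<close> and \<open>z\<close> bounds \<open>\<Delta> z\<close> from below by a weighted mean of
  \<open>sin\<^sup>2 \<angle>(X - m, z - m)\<close>. The sine of the angle between two lines satisfies the triangle inequality,
  so this mean is, uniformly in the direction of \<open>z - m\<close>, at least a multiple of the mean of
  \<open>sin\<^sup>2 \<angle>(X - m, X' - m)\<close> for an independent copy \<open>X'\<close> of \<open>X\<close>, which is positive because \<open>X\<close> is not
  concentrated on a line.

  As the steps are not summable but their squares are, the distance is small with large probability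
  at infinitely many times \<open>n\<close>; a maximal inequality started at such a time shows that it stays
  small afterwards.
\<close>

section \<open>Inner product geometry: triangle deficit and angles between lines\<close>

text \<open>The deficit times the sum of the three norms is \<open>2 * (p * q - c)\<close>, and
  \<open>(p * q - c) * (p * q + c)\<close> is the Gram determinant of \<open>a\<close> and
  \<open>a - d\<close>, hence of \<open>a\<close> and \<open>d\<close>. For \<open>a = X - m\<close>
  and \<open>d = z - m\<close>, the right side compares the distances from \<open>X\<close> to
  \<open>m\<close> and \<open>z\<close> with twice the distance to their midpoint.\<close>

lemma triangle_deficit_ge:
  fixes a d :: "'a::real_inner"
  shows "norm a * ((norm d)\<^sup>2 - (sgn a \<bullet> d)\<^sup>2) / (4 * (norm a + norm d)\<^sup>2)
    \<le> norm a + norm (a - d) - norm (2 *\<^sub>R a - d)"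
proof (cases "a = 0 \<or> a = d")
  case True
  then show ?thesis
  proof
    assume "a = d"
    then have "sgn a \<bullet> d = norm d"
      by (cases "d = 0") (simp_all add: sgn_div_norm dot_square_norm power2_eq_square)
    then show ?thesis using \<open>a = d\<close> by (simp add: scaleR_2)
  qed simp
next
  case False
  define p q s c D where "p = norm a" and "q = norm (a - d)" and "s = norm (2 *\<^sub>R a - d)"
    and "c = a \<bullet> (a - d)" and "D = norm d"
  \<comment> \<open>\<open>\<kappa>\<close> is the squared distance from \<open>d\<close> to the
    line spanned by \<open>a\<close>.\<close>
  define \<kappa> where "\<kappa> = D\<^sup>2 - (sgn a \<bullet> d)\<^sup>2"
  have p: "p > 0" and q: "q > 0" and D: "D \<ge> 0"
    using False by (auto simp: p_def q_def D_def)
  have s: "s \<le> p + q"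
    using norm_triangle_ineq[of a "a - d"] by (simp add: s_def p_def q_def scaleR_2 algebra_simps)
  have qD: "q \<le> p + D"
    unfolding q_def p_def D_def by (rule norm_triangle_ineq4)
  have c: "c \<le> p * q"
    unfolding c_def p_def q_def by (rule norm_cauchy_schwarz)
  have sq: "s\<^sup>2 = p\<^sup>2 + q\<^sup>2 + 2 * c"
    by (simp add: s_def p_def q_def c_def power2_norm_eq_inner inner_diff algebra_simps inner_commute)
  have ad: "(a \<bullet> d)\<^sup>2 = p\<^sup>2 * (sgn a \<bullet> d)\<^sup>2"
  proof -
    have "sgn a \<bullet> d = (a \<bullet> d) / p"
      by (simp add: sgn_div_norm p_def divide_inverse mult.commute)
    then show ?thesis using p by (simp add: power_divide)
  qed
  have ad': "a \<bullet> d = p\<^sup>2 - c"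
    by (simp add: p_def c_def inner_diff power2_norm_eq_inner)
  have q2: "q\<^sup>2 = p\<^sup>2 - 2 * (a \<bullet> d) + D\<^sup>2"
    by (simp add: p_def q_def D_def power2_norm_eq_inner inner_diff inner_commute)
  have gram: "(p * q - c) * (p * q + c) = p\<^sup>2 * \<kappa>"
  proof -
    have "(p * q - c) * (p * q + c) = p\<^sup>2 * q\<^sup>2 - c\<^sup>2"
      by (simp add: power2_eq_square algebra_simps)
    also have "\<dots> = p\<^sup>2 * D\<^sup>2 - (a \<bullet> d)\<^sup>2"
      unfolding q2 ad' by (simp add: power2_eq_square algebra_simps)
    finally show ?thesis unfolding ad \<kappa>_def by (simp add: algebra_simps)
  qed
  have "p\<^sup>2 * \<kappa> \<le> (p * q - c) * (2 * p * q)"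
    unfolding gram[symmetric] using c by (intro mult_left_mono) auto
  then have "p * (p * \<kappa>) \<le> p * (2 * q * (p * q - c))"
    by (simp add: power2_eq_square algebra_simps)
  then have 1: "p * \<kappa> \<le> 2 * q * (p * q - c)"
    using p by simp
  have "2 * (p * q - c) = (p + q - s) * (p + q + s)"
    using sq by (simp add: power2_eq_square algebra_simps)
  also have "\<dots> \<le> (p + q - s) * (2 * (p + q))"
    using s by (intro mult_left_mono) auto
  finally have "p * q - c \<le> (p + q - s) * (p + q)"
    by (simp add: algebra_simps)
  then have "2 * q * (p * q - c) \<le> 2 * q * ((p + q - s) * (p + q))"
    using q by (intro mult_left_mono) auto
  also have "\<dots> = (p + q - s) * ((2 * q) * (p + q))"
    by simp
  \<comment> \<open>After \<open>q\<close> is replaced by \<open>p + D\<close>, the denominator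
    depends on \<open>d\<close> only through its norm, so the weight is the same for all directions
    on a sphere.\<close>
  also have "\<dots> \<le> (p + q - s) * ((2 * (p + D)) * (2 * (p + D)))"
    using s qD p q D by (intro mult_left_mono mult_mono) auto
  also have "\<dots> = (p + q - s) * (4 * (p + D)\<^sup>2)"
    by (simp add: power2_eq_square algebra_simps)
  finally have "p * \<kappa> \<le> (p + q - s) * (4 * (p + D)\<^sup>2)"
    using 1 by linarith
  moreover have "4 * (p + D)\<^sup>2 > 0"
    using p D by (simp add: add_pos_nonneg)
  ultimately have "p * \<kappa> / (4 * (p + D)\<^sup>2) \<le> p + q - s"
    by (simp add: pos_divide_le_eq)
  then show ?thesis
    by (simp add: p_def q_def s_def D_def \<kappa>_def)
qed

text \<open>The squared sine \<open>1 - (u \<bullet> v)\<^sup>2\<close> is the squared distance from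
  \<open>u\<close> to the line of \<open>v\<close>. Projecting \<open>u\<close> onto the line of
  \<open>d\<close>, and the result onto the line of \<open>v\<close>, gives a point of that line
  whose distance from \<open>u\<close> is at most the sum of the two sines; squaring costs the
  factor 2.\<close>

lemma sin_square_triangle:
  fixes u v d :: "'a::real_inner"
  assumes u: "norm u = 1" and v: "norm v = 1" and d: "norm d = 1"
  shows "1 - (u \<bullet> v)\<^sup>2 \<le> 2 * (1 - (u \<bullet> d)\<^sup>2) + 2 * (1 - (v \<bullet> d)\<^sup>2)"
proof -
  define \<alpha> \<beta> where "\<alpha> = u \<bullet> d" and "\<beta> = v \<bullet> d"
  have dots: "u \<bullet> u = 1" "v \<bullet> v = 1" "d \<bullet> d = 1"
    using assms by (simp_all add: dot_square_norm)
  \<comment> \<open>Pythagoras: the nearest point has coefficient \<open>x \<bullet> y\<close>, and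
    any other coefficient \<open>t\<close> adds the last square.\<close>
  have line: "(norm (x - t *\<^sub>R y))\<^sup>2 = 1 - (x \<bullet> y)\<^sup>2 + (t - x \<bullet> y)\<^sup>2"
    if "x \<bullet> x = 1" "y \<bullet> y = 1" for x y :: 'a and t
    using that unfolding power2_norm_eq_inner
    by (simp add: inner_diff inner_commute power2_eq_square algebra_simps)
  have "1 - (u \<bullet> v)\<^sup>2 \<le> (norm (u - (\<alpha> * \<beta>) *\<^sub>R v))\<^sup>2"
    using line[of u v "\<alpha> * \<beta>"] dots by simp
  also have "u - (\<alpha> * \<beta>) *\<^sub>R v = (u - \<alpha> *\<^sub>R d) + \<alpha> *\<^sub>R (d - \<beta> *\<^sub>R v)"
    by (simp add: scaleR_right_diff_distrib)
  also have "(norm \<dots>)\<^sup>2 \<le> 2 * (norm (u - \<alpha> *\<^sub>R d))\<^sup>2 + 2 * (norm (\<alpha> *\<^sub>R (d - \<beta> *\<^sub>R v)))\<^sup>2"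
  proof -
    have "(norm (x + y))\<^sup>2 \<le> 2 * (norm x)\<^sup>2 + 2 * (norm y)\<^sup>2" for x y :: 'a
      using zero_le_power2[of "norm (x - y)"]
      by (simp add: power2_norm_eq_inner inner_diff inner_add inner_commute)
    then show ?thesis .
  qed
  also have "(norm (u - \<alpha> *\<^sub>R d))\<^sup>2 = 1 - \<alpha>\<^sup>2"
    using line[of u d \<alpha>] dots by (simp add: \<alpha>_def)
  also have "(norm (\<alpha> *\<^sub>R (d - \<beta> *\<^sub>R v)))\<^sup>2 = \<alpha>\<^sup>2 * (1 - \<beta>\<^sup>2)"
    using line[of d v \<beta>] dots by (simp add: \<beta>_def power_mult_distrib inner_commute)
  also have "\<alpha>\<^sup>2 * (1 - \<beta>\<^sup>2) \<le> 1 * (1 - \<beta>\<^sup>2)"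
  proof (rule mult_right_mono)
    show "\<alpha>\<^sup>2 \<le> 1" "0 \<le> 1 - \<beta>\<^sup>2"
      using Cauchy_Schwarz_ineq2[of u d] Cauchy_Schwarz_ineq2[of v d] assms
      by (simp_all add: abs_square_le_1 \<alpha>_def \<beta>_def)
  qed
  finally show ?thesis by (simp add: \<alpha>_def \<beta>_def)
qed

section \<open>Non-concentration on lines, uniformly in the direction\<close>

text \<open>A functional orthogonal to \<open>v\<close> is constant along every line of direction
  \<open>v\<close>, so its extended variance would vanish. The case \<open>v = 0\<close> excludes a
  point mass.\<close>

lemma not_concentrated_on_lineD:
  assumes N: "prob_space N" and X[measurable]: "X \<in> borel_measurable N"
    and nc: "not_concentrated_on_line N X"
  shows "\<not> (AE \<omega> in N. \<exists>t. X \<omega> = m + t *\<^sub>R v)"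
proof
  assume line: "AE \<omega> in N. \<exists>t. X \<omega> = m + t *\<^sub>R v"
  obtain w where w: "v \<bullet> w = 0" and var: "0 < ext_variance N (\<lambda>\<omega>. w \<bullet> X \<omega>)"
    using nc unfolding not_concentrated_on_line_def by blast
  have "AE \<omega> in N. w \<bullet> X \<omega> = w \<bullet> m"
    using line by eventually_elim (use w in \<open>auto simp: inner_add inner_commute\<close>)
  moreover have "(\<lambda>\<omega>. w \<bullet> X \<omega>) \<in> borel_measurable N" by simp
  ultimately show False
    using var ext_variance_pos_iff[OF N, of "\<lambda>\<omega>. w \<bullet> X \<omega>"] by blast
qed

text \<open>Equality case of Cauchy--Schwarz: the residual of projecting \<open>sgn x\<close> onto
  \<open>sgn y\<close> has squared norm \<open>1 - c\<^sup>2\<close>.\<close>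

lemma parallel_if_inner_sgn:
  fixes x y :: "'a::real_inner"
  assumes "x \<noteq> 0" "y \<noteq> 0" and 1: "(sgn x \<bullet> sgn y)\<^sup>2 = 1"
  shows "\<exists>t. x = t *\<^sub>R sgn y"
proof -
  define c where "c = sgn x \<bullet> sgn y"
  have n: "norm (sgn x) = 1" "norm (sgn y) = 1"
    using assms by (simp_all add: norm_sgn)
  have "(norm (sgn x - c *\<^sub>R sgn y))\<^sup>2 = (norm (sgn x))\<^sup>2 - 2 * c * c + c\<^sup>2 * (norm (sgn y))\<^sup>2"
    unfolding power2_norm_eq_inner c_def
    by (simp add: inner_diff inner_commute power2_eq_square algebra_simps)
  also have "\<dots> = 0"
    using 1 n by (simp add: c_def power2_eq_square)
  finally have "sgn x = c *\<^sub>R sgn y" by simp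
  moreover have "x = norm x *\<^sub>R sgn x"
    using assms by (simp add: sgn_div_norm)
  ultimately have "x = (norm x * c) *\<^sub>R sgn y"
    by (metis scaleR_scaleR)
  then show ?thesis by blast
qed

text \<open>Positivity for each \<open>d\<close> separately would give no common constant, as the
  unit sphere need not be compact. Instead, the double integral \<open>I\<close> of pairwise squared
  sines does not involve \<open>d\<close>, is positive, and is at most \<open>4 * B\<close> times
  the integral in the conclusion; hence \<open>c\<close> is \<open>I / (4 * B)\<close>.\<close>

lemma uniform_transversal_mass:
  assumes N: "prob_space N" and X[measurable]: "X \<in> borel_measurable N"
    and nc: "not_concentrated_on_line N X"
    and w[measurable]: "w \<in> borel_measurable N"
    and w0: "\<And>\<omega>. 0 \<le> w \<omega>" and wB: "\<And>\<omega>. w \<omega> \<le> B"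
    and wpos: "\<And>\<omega>. w \<omega> = 0 \<longleftrightarrow> X \<omega> = m"
  obtains c where "c > 0"
    "\<And>d. norm d = 1 \<Longrightarrow> c \<le> (\<integral>\<omega>. w \<omega> * (1 - (sgn (X \<omega> - m) \<bullet> d)\<^sup>2) \<partial>N)"
proof -
  interpret prob_space N by fact
  define u where "u \<omega> = sgn (X \<omega> - m)" for \<omega>
  have u[measurable]: "u \<in> borel_measurable N"
    unfolding u_def sgn_div_norm by measurable
  have u1: "norm (u \<omega>) = 1" if "X \<omega> \<noteq> m" for \<omega>
    using that by (simp add: u_def norm_sgn)
  have u_le: "(u \<omega> \<bullet> d)\<^sup>2 \<le> 1" if "norm d \<le> 1" for \<omega> d
  proof -
    have "\<bar>u \<omega> \<bullet> d\<bar> \<le> norm (u \<omega>) * norm d" by (rule Cauchy_Schwarz_ineq2)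
    also have "\<dots> \<le> 1 * 1"
      using that by (intro mult_mono) (auto simp: u_def norm_sgn)
    finally show ?thesis by (simp add: abs_square_le_1)
  qed
  have B: "0 \<le> B" using w0 wB by (meson order_trans)
  define f where "f d = (\<integral>\<^sup>+\<omega>. ennreal (w \<omega> * (1 - (u \<omega> \<bullet> d)\<^sup>2)) \<partial>N)" for d
  \<comment> \<open>The two integrations over \<open>N\<close> stand for \<open>X\<close> and an
    independent copy.\<close>
  define I where "I = (\<integral>\<^sup>+\<omega>'. (\<integral>\<^sup>+\<omega>. ennreal (w \<omega> * w \<omega>' * (1 - (u \<omega> \<bullet> u \<omega>')\<^sup>2)) \<partial>N) \<partial>N)"
  have I_pos: "I > 0"
  proof (rule ccontr)
    assume "\<not> I > 0"
    then have "I = 0" by simp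
    then have AE: "AE \<omega>' in N. AE \<omega> in N. w \<omega> * w \<omega>' * (1 - (u \<omega> \<bullet> u \<omega>')\<^sup>2) \<le> 0"
      unfolding I_def by (simp add: nn_integral_0_iff_AE ennreal_eq_0_iff)
    have "\<not> (AE \<omega> in N. X \<omega> = m)"
      using not_concentrated_on_lineD[OF N X nc, of m 0] by simp
    moreover have "AE \<omega>' in N. X \<omega>' = m"
      if none: "\<And>\<omega>'. X \<omega>' \<noteq> m \<Longrightarrow> \<not> (AE \<omega> in N. w \<omega> * w \<omega>' * (1 - (u \<omega> \<bullet> u \<omega>')\<^sup>2) \<le> 0)"
      using AE by (rule eventually_mono) (use none in blast)
    \<comment> \<open>If \<open>I\<close> vanishes, some value of \<open>X\<close> other than
      \<open>m\<close> is almost surely collinear with \<open>X\<close> as seen from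
      \<open>m\<close>; it supplies the direction of the forbidden line.\<close>
    ultimately obtain \<omega>' where \<omega>': "X \<omega>' \<noteq> m"
        "AE \<omega> in N. w \<omega> * w \<omega>' * (1 - (u \<omega> \<bullet> u \<omega>')\<^sup>2) \<le> 0"
      by blast
    have "AE \<omega> in N. \<exists>t. X \<omega> = m + t *\<^sub>R u \<omega>'"
      using \<omega>'(2)
    proof eventually_elim
      case (elim \<omega>)
      show ?case
      proof (cases "X \<omega> = m")
        case True
        then show ?thesis by (intro exI[of _ 0]) simp
      next
        case False
        have "w \<omega> > 0" "w \<omega>' > 0"
          using w0[of \<omega>] w0[of \<omega>'] wpos[of \<omega>] wpos[of \<omega>'] False \<omega>'(1) by auto
        then have "1 - (u \<omega> \<bullet> u \<omega>')\<^sup>2 \<le> 0"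
          using elim by (simp add: mult_le_0_iff)
        then have "(u \<omega> \<bullet> u \<omega>')\<^sup>2 = 1"
          using u_le[of "u \<omega>'" \<omega>] u1[OF \<omega>'(1)] by simp
        then obtain t where "X \<omega> - m = t *\<^sub>R u \<omega>'"
          using parallel_if_inner_sgn[of "X \<omega> - m" "X \<omega>' - m"] False \<omega>'(1) unfolding u_def by auto
        then show ?thesis by (intro exI[of _ t]) (simp add: algebra_simps)
      qed
    qed
    then show False
      using not_concentrated_on_lineD[OF N X nc] by blast
  qed
  have int_w: "(\<integral>\<^sup>+\<omega>. ennreal (w \<omega>) \<partial>N) \<le> ennreal B"
  proof -
    have "(\<integral>\<^sup>+\<omega>. ennreal (w \<omega>) \<partial>N) \<le> (\<integral>\<^sup>+\<omega>. ennreal B \<partial>N)"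
      by (intro nn_integral_mono ennreal_leI wB)
    then show ?thesis by (simp add: emeasure_space_1)
  qed
  have I_le: "I \<le> ennreal (4 * B) * f d" if d: "norm d = 1" for d
  proof -
    have pt: "ennreal (w \<omega> * w \<omega>' * (1 - (u \<omega> \<bullet> u \<omega>')\<^sup>2))
        \<le> ennreal (2 * w \<omega>') * ennreal (w \<omega> * (1 - (u \<omega> \<bullet> d)\<^sup>2))
          + ennreal (2 * (w \<omega>' * (1 - (u \<omega>' \<bullet> d)\<^sup>2))) * ennreal (w \<omega>)" for \<omega> \<omega>'
    proof -
      have ud: "0 \<le> 1 - (u \<omega> \<bullet> d)\<^sup>2" "0 \<le> 1 - (u \<omega>' \<bullet> d)\<^sup>2"
        using u_le[of d] d by auto
      have "w \<omega> * w \<omega>' * (1 - (u \<omega> \<bullet> u \<omega>')\<^sup>2)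
          \<le> w \<omega> * w \<omega>' * (2 * (1 - (u \<omega> \<bullet> d)\<^sup>2) + 2 * (1 - (u \<omega>' \<bullet> d)\<^sup>2))"
      \<comment> \<open>Where \<open>X\<close> equals \<open>m\<close>, \<open>u\<close> is
        \<open>0\<close> instead of a unit vector, but there the weight vanishes.\<close>
      proof (cases "X \<omega> = m \<or> X \<omega>' = m")
        case True
        then have "w \<omega> = 0 \<or> w \<omega>' = 0" using wpos by auto
        then show ?thesis by auto
      next
        case False
        then show ?thesis
          by (intro mult_left_mono sin_square_triangle mult_nonneg_nonneg w0) (auto simp: u1 d)
      qed
      also have "\<dots> = 2 * w \<omega>' * (w \<omega> * (1 - (u \<omega> \<bullet> d)\<^sup>2))
          + 2 * (w \<omega>' * (1 - (u \<omega>' \<bullet> d)\<^sup>2)) * w \<omega>"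
        by (simp add: algebra_simps)
      finally show ?thesis
        using ud w0 by (simp add: ennreal_mult[symmetric] ennreal_plus[symmetric] ennreal_leI
            del: ennreal_plus)
    qed
    have "I \<le> (\<integral>\<^sup>+\<omega>'. (\<integral>\<^sup>+\<omega>. ennreal (2 * w \<omega>') * ennreal (w \<omega> * (1 - (u \<omega> \<bullet> d)\<^sup>2))
          + ennreal (2 * (w \<omega>' * (1 - (u \<omega>' \<bullet> d)\<^sup>2))) * ennreal (w \<omega>) \<partial>N) \<partial>N)"
      unfolding I_def by (intro nn_integral_mono pt)
    also have "\<dots> = (\<integral>\<^sup>+\<omega>'. ennreal (2 * w \<omega>') * f d
          + ennreal (2 * (w \<omega>' * (1 - (u \<omega>' \<bullet> d)\<^sup>2))) * (\<integral>\<^sup>+\<omega>. ennreal (w \<omega>) \<partial>N) \<partial>N)"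
      by (simp add: nn_integral_add nn_integral_cmult f_def)
    also have "\<dots> = 2 * (\<integral>\<^sup>+\<omega>. ennreal (w \<omega>) \<partial>N) * f d + 2 * f d * (\<integral>\<^sup>+\<omega>. ennreal (w \<omega>) \<partial>N)"
      by (simp add: nn_integral_add nn_integral_multc nn_integral_cmult f_def ennreal_mult')
    also have "\<dots> \<le> 2 * ennreal B * f d + 2 * f d * ennreal B"
      by (intro add_mono mult_mono int_w) auto
    also have "\<dots> = (2 * ennreal B + 2 * ennreal B) * f d"
      by (simp add: distrib_left distrib_right mult_ac)
    also have "2 * ennreal B + 2 * ennreal B = ennreal (4 * B)"
      using B by (simp add: ennreal_mult[symmetric] ennreal_plus[symmetric] flip: ennreal_numeral
            del: ennreal_plus)
    finally show ?thesis .
  qed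
  have f_eq: "f d = ennreal (\<integral>\<omega>. w \<omega> * (1 - (u \<omega> \<bullet> d)\<^sup>2) \<partial>N)" if d: "norm d = 1" for d
    unfolding f_def
  proof (rule nn_integral_eq_integral)
    have "0 \<le> 1 - (u \<omega> \<bullet> d)\<^sup>2" for \<omega> using u_le[of d \<omega>] d by simp
    then show "AE \<omega> in N. 0 \<le> w \<omega> * (1 - (u \<omega> \<bullet> d)\<^sup>2)"
      using w0 by simp
    have "norm (w \<omega> * (1 - (u \<omega> \<bullet> d)\<^sup>2)) \<le> B * 1" for \<omega>
      unfolding norm_mult using w0 wB u_le[of d \<omega>] d B by (intro mult_mono) auto
    then show "integrable N (\<lambda>\<omega>. w \<omega> * (1 - (u \<omega> \<bullet> d)\<^sup>2))"
      by (intro integrable_const_bound[where B = "B * 1"]) auto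
  qed
  show ?thesis
  \<comment> \<open>The zero space has no unit vector and any constant serves. Otherwise a single
    unit vector suffices to see that \<open>B\<close> is positive and \<open>I\<close>
    finite.\<close>
  proof (cases "\<exists>d::'b. norm d = 1")
    case False
    then show ?thesis using that[of 1] by auto
  next
    case True
    then obtain d0 :: 'b where d0: "norm d0 = 1" by blast
    have B_pos: "B > 0"
    proof (rule ccontr)
      assume "\<not> B > 0"
      then show False using I_le[OF d0] I_pos B by simp
    qed
    have I_fin: "I < \<infinity>"
      using I_le[OF d0] f_eq[OF d0] by (simp add: ennreal_mult_less_top le_less_trans)
    then obtain i where i: "I = ennreal i" "i > 0"
      using I_pos by (cases I) (auto simp: ennreal_less_zero_iff)
    show ?thesis
    proof (rule that)
      show "i / (4 * B) > 0" using i B_pos by simp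
      fix d :: 'b assume d: "norm d = 1"
      let ?r = "\<integral>\<omega>. w \<omega> * (1 - (u \<omega> \<bullet> d)\<^sup>2) \<partial>N"
      have r: "0 \<le> ?r"
      proof (rule Bochner_Integration.integral_nonneg)
        show "0 \<le> w \<omega> * (1 - (u \<omega> \<bullet> d)\<^sup>2)" for \<omega>
          using w0[of \<omega>] u_le[of d \<omega>] d by simp
      qed
      have "ennreal i \<le> ennreal (4 * B * ?r)"
        using I_le[OF d] B r by (simp add: i f_eq[OF d] ennreal_mult)
      then have "i \<le> 4 * B * ?r"
        using B r by (subst (asm) ennreal_le_iff) auto
      then show "i / (4 * B) \<le> (\<integral>\<omega>. w \<omega> * (1 - (sgn (X \<omega> - m) \<bullet> d)\<^sup>2) \<partial>N)"
        using B_pos by (simp add: u_def pos_divide_le_eq mult_ac)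
    qed
  qed
qed

section \<open>The median objective and its growth away from the median\<close>

text \<open>The reverse triangle inequality bounds the integrand by \<open>norm (z - y)\<close>,
  even when \<open>X\<close> has no first moment.\<close>

lemma integrable_norm_diff:
  fixes X :: "'v \<Rightarrow> 'a::{real_inner, banach, second_countable_topology}"
  assumes "prob_space N" and [measurable]: "X \<in> borel_measurable N"
  shows "integrable N (\<lambda>\<omega>. norm (X \<omega> - y) - norm (X \<omega> - z))"
proof -
  interpret prob_space N by fact
  have "\<bar>norm (X \<omega> - y) - norm (X \<omega> - z)\<bar> \<le> norm (z - y)" for \<omega>
    using norm_triangle_ineq3[of "X \<omega> - y" "X \<omega> - z"] by simp
  then show ?thesis
    by (intro integrable_const_bound[where B = "norm (z - y)"]) auto
qed

text \<open>Moving the reference point from \<open>0\<close> to \<open>m\<close> changes the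
  objective only by a constant.\<close>

lemma geometric_median_minimal:
  fixes X :: "'v \<Rightarrow> 'a::{real_inner, banach, second_countable_topology}"
  assumes N: "prob_space N" and X: "X \<in> borel_measurable N"
    and med: "is_geometric_median N X m"
  shows "0 \<le> (\<integral>\<omega>. norm (X \<omega> - z) - norm (X \<omega> - m) \<partial>N)"
proof -
  have int: "integrable N (\<lambda>\<omega>. norm (X \<omega> - u) - norm (X \<omega>))" for u
    using integrable_norm_diff[OF N X, of u 0] by simp
  have "(\<integral>\<omega>. norm (X \<omega> - m) - norm (X \<omega>) \<partial>N) \<le> (\<integral>\<omega>. norm (X \<omega> - z) - norm (X \<omega>) \<partial>N)"
    using med unfolding is_geometric_median_def is_arg_min_def by (auto simp: not_less)
  then have "0 \<le> (\<integral>\<omega>. (norm (X \<omega> - z) - norm (X \<omega>)) - (norm (X \<omega> - m) - norm (X \<omega>)) \<partial>N)"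
    by (subst Bochner_Integration.integral_diff[OF int int]) simp
  then show ?thesis by simp
qed

text \<open>
  On the sphere of radius \<open>\<epsilon>\<close> about \<open>m\<close>, the optimality of \<open>m\<close> is used at the midpoint of \<open>m\<close> and
  \<open>z\<close>, so no differentiability of the objective at \<open>m\<close> is needed; convexity extends the bound to the
  outside of the sphere.
\<close>
lemma geometric_median_excess:
  fixes X :: "'v \<Rightarrow> 'a::{real_inner, banach, second_countable_topology}"
  assumes N: "prob_space N" and X[measurable]: "X \<in> borel_measurable N"
    and nc: "not_concentrated_on_line N X"
    and med: "is_geometric_median N X m" and \<epsilon>: "\<epsilon> > 0"
  obtains \<delta> where "\<delta> > 0"
    "\<And>z. \<epsilon> \<le> norm (z - m) \<Longrightarrow> \<delta> \<le> (\<integral>\<omega>. norm (X \<omega> - z) - norm (X \<omega> - m) \<partial>N)"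
proof -
  interpret prob_space N by fact
  define \<Delta> where "\<Delta> z = (\<integral>\<omega>. norm (X \<omega> - z) - norm (X \<omega> - m) \<partial>N)" for z
  note int = integrable_norm_diff[OF N X]
  \<comment> \<open>This is the weight in \<open>triangle_deficit_ge\<close> for
    \<open>a = X \<omega> - m\<close> and a displacement of norm \<open>\<epsilon>\<close>. It is
    bounded and vanishes exactly where \<open>X\<close> equals \<open>m\<close>, as
    \<open>uniform_transversal_mass\<close> requires.\<close>
  define w where "w \<omega> = norm (X \<omega> - m) / (4 * (norm (X \<omega> - m) + \<epsilon>)\<^sup>2)" for \<omega>
  have w[measurable]: "w \<in> borel_measurable N" unfolding w_def by measurable
  have pos: "0 < 4 * (norm (X \<omega> - m) + \<epsilon>)\<^sup>2" for \<omega>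
  proof -
    have "0 < norm (X \<omega> - m) + \<epsilon>" using \<epsilon> by (simp add: add_nonneg_pos)
    then show ?thesis by simp
  qed
  have w_le: "w \<omega> \<le> 1 / \<epsilon>" for \<omega>
  proof -
    define p where "p = norm (X \<omega> - m)"
    have "p * \<epsilon> \<le> 4 * (p + \<epsilon>)\<^sup>2"
      using \<epsilon> by (simp add: p_def power2_eq_square algebra_simps add_increasing)
    then show ?thesis
      using pos[of \<omega>] \<epsilon> by (simp add: w_def p_def[symmetric] divide_simps mult.commute)
  qed
  have w_ge: "0 \<le> w \<omega>" for \<omega> by (simp add: w_def)
  have w_0: "w \<omega> = 0 \<longleftrightarrow> X \<omega> = m" for \<omega>
    using pos[of \<omega>] by (auto simp: w_def)
  obtain c where c: "c > 0"
      "\<And>d. norm d = 1 \<Longrightarrow> c \<le> (\<integral>\<omega>. w \<omega> * (1 - (sgn (X \<omega> - m) \<bullet> d)\<^sup>2) \<partial>N)"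
    using uniform_transversal_mass[OF N X nc w w_ge w_le w_0] by blast
  have sphere: "\<epsilon>\<^sup>2 * c \<le> \<Delta> (m + \<epsilon> *\<^sub>R d)" if d: "norm d = 1" for d
  proof -
    let ?u = "\<lambda>\<omega>. sgn (X \<omega> - m)"
    have u[measurable]: "?u \<in> borel_measurable N"
      unfolding sgn_div_norm by measurable
    let ?z = "m + \<epsilon> *\<^sub>R d" and ?y = "m + (\<epsilon> / 2) *\<^sub>R d"
    \<comment> \<open>\<open>?y\<close> is the midpoint of \<open>m\<close> and \<open>?z\<close>;
      after cancellation the right side is the triangle deficit.\<close>
    have pt: "\<epsilon>\<^sup>2 * (w \<omega> * (1 - (?u \<omega> \<bullet> d)\<^sup>2))
        \<le> (norm (X \<omega> - ?z) - norm (X \<omega> - m)) - 2 * (norm (X \<omega> - ?y) - norm (X \<omega> - m))" for \<omega>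
    proof -
      have "norm (2 *\<^sub>R (X \<omega> - m) - \<epsilon> *\<^sub>R d) = norm (2 *\<^sub>R (X \<omega> - ?y))"
        by (simp add: algebra_simps)
      also have "\<dots> = 2 * norm (X \<omega> - ?y)" by simp
      finally show ?thesis
        using triangle_deficit_ge[of "X \<omega> - m" "\<epsilon> *\<^sub>R d"] d \<epsilon>
        by (simp add: w_def power_mult_distrib algebra_simps diff_divide_distrib)
    qed
    have bnd: "norm (w \<omega> * (1 - (?u \<omega> \<bullet> d)\<^sup>2)) \<le> (1 / \<epsilon>) * 1" for \<omega>
    proof -
      have "\<bar>?u \<omega> \<bullet> d\<bar> \<le> norm (?u \<omega>) * norm d" by (rule Cauchy_Schwarz_ineq2)
      also have "\<dots> \<le> 1" using d by (simp add: norm_sgn)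
      finally have "(?u \<omega> \<bullet> d)\<^sup>2 \<le> 1" by (simp add: abs_square_le_1)
      then show ?thesis
        unfolding norm_mult using w_ge w_le \<epsilon> by (intro mult_mono) auto
    qed
    have int_w: "integrable N (\<lambda>\<omega>. w \<omega> * (1 - (?u \<omega> \<bullet> d)\<^sup>2))"
      using bnd by (intro integrable_const_bound[where B = "(1 / \<epsilon>) * 1"]) auto
    have "\<epsilon>\<^sup>2 * c \<le> \<epsilon>\<^sup>2 * (\<integral>\<omega>. w \<omega> * (1 - (?u \<omega> \<bullet> d)\<^sup>2) \<partial>N)"
      using c(2)[OF d] by (intro mult_left_mono) auto
    also have "\<dots> = (\<integral>\<omega>. \<epsilon>\<^sup>2 * (w \<omega> * (1 - (?u \<omega> \<bullet> d)\<^sup>2)) \<partial>N)"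
      by simp
    also have "\<dots> \<le> (\<integral>\<omega>. (norm (X \<omega> - ?z) - norm (X \<omega> - m)) - 2 * (norm (X \<omega> - ?y) - norm (X \<omega> - m)) \<partial>N)"
      by (intro integral_mono pt Bochner_Integration.integrable_diff integrable_mult_right int int_w)
    also have "\<dots> = \<Delta> ?z - 2 * \<Delta> ?y"
      unfolding \<Delta>_def
      by (simp only: Bochner_Integration.integral_diff int integrable_mult_right integral_mult_right_zero)
    \<comment> \<open>Minimality of \<open>m\<close> is applied at the midpoint:
      \<open>\<Delta> ?y\<close> is nonnegative.\<close>
    also have "\<dots> \<le> \<Delta> ?z"
      using geometric_median_minimal[OF N X med, of ?y] by (simp add: \<Delta>_def)
    finally show ?thesis .
  qed
  show ?thesis
  proof (rule that)
    show "\<epsilon>\<^sup>2 * c > 0" using \<epsilon> c by simp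
    fix z assume z: "\<epsilon> \<le> norm (z - m)"
    define r where "r = norm (z - m)"
    \<comment> \<open>\<open>t\<close> is the position, on the segment from \<open>m\<close> to
      \<open>z\<close>, of the point at distance \<open>\<epsilon>\<close> from
      \<open>m\<close>.\<close>
    define t where "t = \<epsilon> / r"
    have r: "r > 0" "\<epsilon> \<le> r" using z \<epsilon> unfolding r_def by linarith+
    have t: "0 \<le> t" "t \<le> 1" using r \<epsilon> by (simp_all add: t_def)
    let ?d = "sgn (z - m)"
    have d: "norm ?d = 1"
    proof -
      have "z - m \<noteq> 0" using r by (auto simp: r_def)
      then show ?thesis by (simp add: norm_sgn)
    qed
    have eq: "X \<omega> - (m + \<epsilon> *\<^sub>R ?d) = (1 - t) *\<^sub>R (X \<omega> - m) + t *\<^sub>R (X \<omega> - z)" for \<omega>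
    proof -
      have "\<epsilon> *\<^sub>R ?d = t *\<^sub>R (z - m)"
        by (simp add: sgn_div_norm t_def r_def divide_inverse)
      then show ?thesis by (simp add: algebra_simps)
    qed
    have "norm (X \<omega> - (m + \<epsilon> *\<^sub>R ?d)) \<le> (1 - t) * norm (X \<omega> - m) + t * norm (X \<omega> - z)" for \<omega>
      unfolding eq by (rule order_trans[OF norm_triangle_ineq]) (use t in simp)
    then have "norm (X \<omega> - (m + \<epsilon> *\<^sub>R ?d)) - norm (X \<omega> - m) \<le> t * (norm (X \<omega> - z) - norm (X \<omega> - m))" for \<omega>
      by (simp add: algebra_simps)
    then have "\<Delta> (m + \<epsilon> *\<^sub>R ?d) \<le> (\<integral>\<omega>. t * (norm (X \<omega> - z) - norm (X \<omega> - m)) \<partial>N)"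
      unfolding \<Delta>_def by (intro integral_mono integrable_mult_right int)
    also have "\<dots> = t * \<Delta> z" by (simp add: \<Delta>_def)
    also have "\<dots> \<le> 1 * \<Delta> z"
      using t geometric_median_minimal[OF N X med, of z] by (intro mult_right_mono) (auto simp: \<Delta>_def)
    finally show "\<epsilon>\<^sup>2 * c \<le> (\<integral>\<omega>. norm (X \<omega> - z) - norm (X \<omega> - m) \<partial>N)"
      using sphere[OF d] by (simp add: \<Delta>_def)
  qed
qed

section \<open>Mean decrease of the squared distance in one step\<close>

text \<open>Expanding the square, the cross term is controlled by the subgradient inequality for the
  norm and the quadratic term by \<open>g\<^sup>2\<close>. The gain stands as a summand on the left
  because subtraction in \<open>ennreal\<close> truncates. With \<open>e = 0\<close> the bound also
  serves for iterates close to \<open>m\<close>.\<close>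

lemma normalized_step_contracts:
  fixes X :: "'v \<Rightarrow> 'a::{real_inner, banach, second_countable_topology}"
  assumes N: "prob_space N" and X[measurable]: "X \<in> borel_measurable N" and g: "g \<ge> 0"
    and excess: "e \<le> (\<integral>\<omega>. norm (X \<omega> - z) - norm (X \<omega> - m) \<partial>N)" and e: "e \<ge> 0"
  shows "(\<integral>\<^sup>+\<omega>. ennreal ((norm (z + g *\<^sub>R sgn (X \<omega> - z) - m))\<^sup>2) \<partial>N) + ennreal (2 * g * e)
    \<le> ennreal ((norm (z - m))\<^sup>2) + ennreal (g\<^sup>2)"
proof -
  interpret prob_space N by fact
  let ?V = "\<lambda>\<omega>. (norm (z + g *\<^sub>R sgn (X \<omega> - z) - m))\<^sup>2"
  let ?B = "\<lambda>\<omega>. ((norm (z - m))\<^sup>2 + g\<^sup>2) - 2 * g * (norm (X \<omega> - z) - norm (X \<omega> - m))"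
  have pt: "?V \<omega> \<le> ?B \<omega>" for \<omega>
  proof -
    let ?s = "sgn (X \<omega> - z)"
    have s1: "norm ?s \<le> 1" by (simp add: norm_sgn)
    have "?s \<bullet> (z - m) = ?s \<bullet> (X \<omega> - m) - ?s \<bullet> (X \<omega> - z)"
      by (simp add: inner_diff)
    also have "?s \<bullet> (X \<omega> - m) \<le> 1 * norm (X \<omega> - m)"
      by (rule order_trans[OF norm_cauchy_schwarz]) (intro mult_right_mono s1, simp)
    also have "?s \<bullet> (X \<omega> - z) = norm (X \<omega> - z)"
      by (cases "X \<omega> = z") (simp_all add: sgn_div_norm dot_square_norm power2_eq_square)
    finally have s: "?s \<bullet> (z - m) \<le> norm (X \<omega> - m) - norm (X \<omega> - z)" by simp
    have "?V \<omega> = (norm (z - m))\<^sup>2 + 2 * g * (?s \<bullet> (z - m)) + g\<^sup>2 * (norm ?s)\<^sup>2"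
    proof -
      have "(norm (a + g *\<^sub>R b))\<^sup>2 = (norm a)\<^sup>2 + 2 * g * (b \<bullet> a) + g\<^sup>2 * (norm b)\<^sup>2" for a b :: 'a
        unfolding power2_norm_eq_inner
        by (simp add: inner_add inner_commute power2_eq_square algebra_simps)
      from this[of "z - m" ?s] show ?thesis by (simp add: algebra_simps)
    qed
    also have "\<dots> \<le> (norm (z - m))\<^sup>2 + 2 * g * (norm (X \<omega> - m) - norm (X \<omega> - z)) + g\<^sup>2 * 1"
      using s s1 g by (intro add_mono mult_left_mono) (auto simp: power_le_one)
    finally show ?thesis by (simp add: algebra_simps)
  qed
  have int: "integrable N ?B"
    by (intro Bochner_Integration.integrable_diff integrable_mult_right integrable_norm_diff N X) simp
  \<comment> \<open>\<open>?B\<close> inherits nonnegativity from the square \<open>?V\<close>,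
    which allows its nonnegative integral to be turned into a Bochner integral.\<close>
  have B0: "0 \<le> ?B \<omega>" for \<omega>
    using pt[of \<omega>] by (rule order_trans[rotated]) simp
  have "(\<integral>\<^sup>+\<omega>. ennreal (?V \<omega>) \<partial>N) \<le> (\<integral>\<^sup>+\<omega>. ennreal (?B \<omega>) \<partial>N)"
    by (intro nn_integral_mono ennreal_leI pt)
  also have "\<dots> = ennreal (\<integral>\<omega>. ?B \<omega> \<partial>N)"
    by (intro nn_integral_eq_integral int AE_I2 B0)
  finally have "(\<integral>\<^sup>+\<omega>. ennreal (?V \<omega>) \<partial>N) + ennreal (2 * g * e) \<le> ennreal (\<integral>\<omega>. ?B \<omega> \<partial>N) + ennreal (2 * g * e)"
    by (rule add_right_mono)
  also have "\<dots> = ennreal ((\<integral>\<omega>. ?B \<omega> \<partial>N) + 2 * g * e)"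
    using g e by (intro ennreal_plus[symmetric] Bochner_Integration.integral_nonneg B0) simp
  also have "\<dots> \<le> ennreal ((norm (z - m))\<^sup>2 + g\<^sup>2)"
  proof (rule ennreal_leI)
    have "(\<integral>\<omega>. ?B \<omega> \<partial>N) = (\<integral>\<omega>. (norm (z - m))\<^sup>2 + g\<^sup>2 \<partial>N)
        - 2 * g * (\<integral>\<omega>. norm (X \<omega> - z) - norm (X \<omega> - m) \<partial>N)"
      by (subst Bochner_Integration.integral_diff)
        (simp_all add: integrable_norm_diff[OF N X] integral_mult_right_zero)
    also have "\<dots> \<le> (norm (z - m))\<^sup>2 + g\<^sup>2 - 2 * g * e"
      using excess g by (simp add: prob_space mult_left_mono)
    finally show "(\<integral>\<omega>. ?B \<omega> \<partial>N) + 2 * g * e \<le> (norm (z - m))\<^sup>2 + g\<^sup>2" by simp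
  qed
  also have "\<dots> = ennreal ((norm (z - m))\<^sup>2) + ennreal (g\<^sup>2)"
    by (intro ennreal_plus) auto
  finally show ?thesis .
qed

section \<open>Almost sure convergence from an integrated drift inequality\<close>

text \<open>\<open>step\<close> is a conditional drift inequality integrated over the events of
  \<open>F k\<close>, so no conditional expectation is formed. On the whole space it forces
  \<open>V n\<close> to be small in probability at arbitrarily late \<open>n\<close>; on smaller
  events it yields a maximal inequality from such an \<open>n\<close> on.\<close>

lemma almost_supermartingale_tendsto_0:
  fixes V :: "nat \<Rightarrow> 'w \<Rightarrow> real" and F :: "nat \<Rightarrow> 'w measure" and \<gamma> :: "nat \<Rightarrow> real"
  assumes M: "prob_space M"
    and F: "\<And>k. subalgebra M (F k)" "\<And>j k. j \<le> k \<Longrightarrow> sets (F j) \<subseteq> sets (F k)"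
    and V: "\<And>k. V k \<in> borel_measurable (F k)" and V_nonneg: "\<And>k \<omega>. 0 \<le> V k \<omega>"
    and V0: "(\<integral>\<^sup>+\<omega>. ennreal (V 0 \<omega>) \<partial>M) < \<infinity>"
    and \<gamma>: "\<And>k. 0 < \<gamma> k" "\<not> summable \<gamma>" "summable (\<lambda>k. (\<gamma> k)\<^sup>2)"
    and step: "\<And>\<epsilon>. 0 < \<epsilon> \<Longrightarrow> \<exists>\<delta>>0. \<forall>k. \<forall>D\<in>sets (F k).
      (\<integral>\<^sup>+\<omega>\<in>D. ennreal (V (Suc k) \<omega>) \<partial>M)
        + ennreal (\<gamma> k * \<delta>) * emeasure M {\<omega>\<in>D. \<epsilon> \<le> V k \<omega>}
      \<le> (\<integral>\<^sup>+\<omega>\<in>D. ennreal (V k \<omega>) \<partial>M) + ennreal ((\<gamma> k)\<^sup>2)"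
  shows "AE \<omega> in M. (\<lambda>k. V k \<omega>) \<longlonglongrightarrow> 0"
proof -
  interpret prob_space M by fact
  have space_F: "space (F k) = space M" for k
    using F(1)[of k] by (simp add: subalgebra_def)
  have V_F: "V j \<in> borel_measurable (F k)" if "j \<le> k" for j k
    using V[of j] F(2)[OF that] space_F by (auto simp: measurable_def)
  have V_M[measurable]: "V k \<in> borel_measurable M" for k
    using measurable_from_subalg[OF F(1) V] .

  \<comment> \<open>If these probabilities stayed above \<open>\<eta>\<close>, the total decrease
    would dominate a multiple of the divergent series of steps, while \<open>v 0\<close> and the sum
    of squares are finite.\<close>
  have frequently_small: "\<exists>n\<ge>n0. prob {\<omega>\<in>space M. \<epsilon> \<le> V n \<omega>} < \<eta>"
    if "\<epsilon> > 0" "\<eta> > 0" for \<epsilon> \<eta> n0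
  proof (rule ccontr)
    define p where "p n = prob {\<omega>\<in>space M. \<epsilon> \<le> V n \<omega>}" for n
    assume "\<not> ?thesis"
    then have p_ge: "\<eta> \<le> p n" if "n \<ge> n0" for n
      using that by (auto simp: p_def not_less)
    obtain \<delta> where \<delta>: "\<delta> > 0" and drift: "\<And>k D. D \<in> sets (F k) \<Longrightarrow>
        (\<integral>\<^sup>+\<omega>\<in>D. ennreal (V (Suc k) \<omega>) \<partial>M)
          + ennreal (\<gamma> k * \<delta>) * emeasure M {\<omega>\<in>D. \<epsilon> \<le> V k \<omega>}
        \<le> (\<integral>\<^sup>+\<omega>\<in>D. ennreal (V k \<omega>) \<partial>M) + ennreal ((\<gamma> k)\<^sup>2)"
      using step[OF \<open>\<epsilon> > 0\<close>] by blast
    define v where "v k = (\<integral>\<^sup>+\<omega>. ennreal (V k \<omega>) \<partial>M)" for k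
    have drift': "v (Suc k) + ennreal (\<gamma> k * \<delta> * p k) \<le> v k + ennreal ((\<gamma> k)\<^sup>2)" for k
    proof -
      have "(\<integral>\<^sup>+\<omega>\<in>space M. ennreal (V j \<omega>) \<partial>M) = v j" for j
        unfolding v_def by (intro nn_integral_cong) simp
      moreover have "ennreal (\<gamma> k * \<delta>) * emeasure M {\<omega>\<in>space M. \<epsilon> \<le> V k \<omega>} = ennreal (\<gamma> k * \<delta> * p k)"
        using \<delta> \<gamma>(1)[of k] by (simp add: p_def emeasure_eq_measure ennreal_mult[symmetric])
      ultimately show ?thesis
        using drift[of "space M" k] space_F[of k] sets.top[of "F k"] by simp
    qed
    have sum_le: "v n + ennreal (\<Sum>k<n. \<gamma> k * \<delta> * p k) \<le> v 0 + ennreal (\<Sum>k<n. (\<gamma> k)\<^sup>2)" for n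
    proof (induction n)
      case (Suc n)
      have nonneg: "0 \<le> (\<Sum>k<n. \<gamma> k * \<delta> * p k)" "0 \<le> \<gamma> n * \<delta> * p n" "0 \<le> (\<Sum>k<n. (\<gamma> k)\<^sup>2)"
        using \<delta> \<gamma>(1)[THEN less_imp_le] by (auto intro!: sum_nonneg mult_nonneg_nonneg simp: p_def)
      have "v (Suc n) + ennreal (\<Sum>k<Suc n. \<gamma> k * \<delta> * p k)
          = (v (Suc n) + ennreal (\<gamma> n * \<delta> * p n)) + ennreal (\<Sum>k<n. \<gamma> k * \<delta> * p k)"
        using nonneg by (simp add: ennreal_plus ac_simps)
      also have "\<dots> \<le> (v n + ennreal ((\<gamma> n)\<^sup>2)) + ennreal (\<Sum>k<n. \<gamma> k * \<delta> * p k)"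
        by (intro add_mono drift' order_refl)
      also have "\<dots> = (v n + ennreal (\<Sum>k<n. \<gamma> k * \<delta> * p k)) + ennreal ((\<gamma> n)\<^sup>2)"
        by (simp add: ac_simps)
      also have "\<dots> \<le> (v 0 + ennreal (\<Sum>k<n. (\<gamma> k)\<^sup>2)) + ennreal ((\<gamma> n)\<^sup>2)"
        by (intro add_mono Suc.IH order_refl)
      also have "\<dots> = v 0 + ennreal (\<Sum>k<Suc n. (\<gamma> k)\<^sup>2)"
        using nonneg by (simp add: ennreal_plus ac_simps)
      finally show ?case .
    qed simp
    obtain v0 where v0: "v 0 = ennreal v0" "0 \<le> v0"
      using V0 unfolding v_def[symmetric] by (cases "v 0") auto
    have bound: "(\<Sum>k<n. \<gamma> k * \<delta> * p k) \<le> v0 + (\<Sum>k. (\<gamma> k)\<^sup>2)" for n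
    proof -
      have "ennreal (\<Sum>k<n. \<gamma> k * \<delta> * p k) \<le> ennreal v0 + ennreal (\<Sum>k<n. (\<gamma> k)\<^sup>2)"
        by (rule order_trans[OF _ sum_le[of n, unfolded v0(1)]]) (simp add: add_increasing)
      also have "\<dots> = ennreal (v0 + (\<Sum>k<n. (\<gamma> k)\<^sup>2))"
        using v0 by (simp add: sum_nonneg)
      finally have "(\<Sum>k<n. \<gamma> k * \<delta> * p k) \<le> v0 + (\<Sum>k<n. (\<gamma> k)\<^sup>2)"
        using v0 by (subst (asm) ennreal_le_iff) (auto intro!: add_nonneg_nonneg sum_nonneg)
      also have "(\<Sum>k<n. (\<gamma> k)\<^sup>2) \<le> (\<Sum>k. (\<gamma> k)\<^sup>2)"
        by (intro sum_le_suminf \<gamma>) auto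
      finally show ?thesis by simp
    qed
    have "summable (\<lambda>k. \<gamma> k * \<delta> * p k)"
    proof (rule bounded_imp_summable)
      show "0 \<le> \<gamma> k * \<delta> * p k" for k
        using \<delta> \<gamma>(1)[of k] by (simp add: p_def)
      show "(\<Sum>k\<le>n. \<gamma> k * \<delta> * p k) \<le> v0 + (\<Sum>k. (\<gamma> k)\<^sup>2)" for n
        unfolding lessThan_Suc_atMost[symmetric] by (rule bound)
    qed
    then have "summable (\<lambda>k. \<gamma> k * (\<delta> * \<eta>))"
    proof (rule summable_comparison_test'[of _ n0])
      fix k assume "n0 \<le> k"
      then show "norm (\<gamma> k * (\<delta> * \<eta>)) \<le> \<gamma> k * \<delta> * p k"
        using \<gamma>(1)[of k] \<delta> \<open>\<eta> > 0\<close> p_ge[of k] by (simp add: abs_mult)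
    qed
    then have "summable (\<lambda>k. \<gamma> k * (\<delta> * \<eta>) * inverse (\<delta> * \<eta>))"
      by (rule summable_mult2)
    then show False
      using \<gamma>(2) \<delta> \<open>\<eta> > 0\<close> by (simp add: field_simps)
  qed

  \<comment> \<open>The gain is dropped, so any level would do; \<open>1\<close> is chosen.\<close>
  have one_step: "(\<integral>\<^sup>+\<omega>\<in>D. ennreal (V (Suc k) \<omega>) \<partial>M)
      \<le> (\<integral>\<^sup>+\<omega>\<in>D. ennreal (V k \<omega>) \<partial>M) + ennreal ((\<gamma> k)\<^sup>2)" if "D \<in> sets (F k)" for k D
  proof -
    obtain \<delta> where *: "\<And>k D. D \<in> sets (F k) \<Longrightarrow>
        (\<integral>\<^sup>+\<omega>\<in>D. ennreal (V (Suc k) \<omega>) \<partial>M)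
          + ennreal (\<gamma> k * \<delta>) * emeasure M {\<omega>\<in>D. 1 \<le> V k \<omega>}
        \<le> (\<integral>\<^sup>+\<omega>\<in>D. ennreal (V k \<omega>) \<partial>M) + ennreal ((\<gamma> k)\<^sup>2)"
      using step[OF zero_less_one] by blast
    show ?thesis
      by (rule order_trans[OF _ *[OF that]]) (rule add_increasing2[OF zero_le order_refl])
  qed

  text \<open>
    Doob's maximal inequality, with the stopping time replaced by the decreasing events \<open>D k\<close>
    that the level \<open>\<beta>\<close> has not been reached between the times \<open>n\<close> and \<open>n + k\<close>.
  \<close>
  have maximal: "prob {\<omega>\<in>space M. V n \<omega> < e \<and> (\<exists>k\<ge>n. \<beta> \<le> V k \<omega>)} \<le> (e + (\<Sum>k. (\<gamma> (k + n))\<^sup>2)) / \<beta>"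
    if "0 < e" "e \<le> \<beta>" for n e \<beta>
  proof -
    define D where "D k = {\<omega>\<in>space M. V n \<omega> < e \<and> (\<forall>j\<in>{n..n + k}. V j \<omega> < \<beta>)}" for k
    have \<beta>: "\<beta> > 0" using that by simp
    have D_F: "D k \<in> sets (F (n + k))" for k
    proof -
      have [measurable]: "V j \<in> borel_measurable (F (n + k))" if "j \<in> {n..n + k}" for j
        using V_F[of j "n + k"] that by simp
      have "{\<omega>\<in>space (F (n + k)). V n \<omega> < e \<and> (\<forall>j\<in>{n..n + k}. V j \<omega> < \<beta>)} \<in> sets (F (n + k))"
        by (intro sets.sets_Collect sets.sets_Collect_finite_All') (auto simp: V_F)
      then show ?thesis by (simp add: D_def space_F)
    qed
    have D_M[measurable]: "D k \<in> sets M" for k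
      using D_F[of k] F(1)[of "n + k"] by (auto simp: subalgebra_def)
    have D_mono: "D (Suc k) \<subseteq> D k" for k
      by (auto simp: D_def)
    have D_anti: "D k \<subseteq> D j" if "j \<le> k" for j k
      using lift_Suc_antimono_le[of D, OF D_mono that] .
    \<comment> \<open>The left side is a lower bound for the mean of the stopped process on
      \<open>D 0\<close>: paths still in \<open>D k\<close> count with their current value, those
      that have left count with \<open>\<beta>\<close>.\<close>
    have stopped: "(\<integral>\<^sup>+\<omega>\<in>D k. ennreal (V (n + k) \<omega>) \<partial>M) + ennreal \<beta> * emeasure M (D 0 - D k)
        \<le> ennreal e + ennreal (\<Sum>j<k. (\<gamma> (j + n))\<^sup>2)" for k
    proof (induction k)
      case 0
      have "(\<integral>\<^sup>+\<omega>\<in>D 0. ennreal (V n \<omega>) \<partial>M) \<le> (\<integral>\<^sup>+\<omega>. ennreal e \<partial>M)"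
        by (intro nn_integral_mono) (auto simp: D_def indicator_def intro!: ennreal_leI)
      then show ?case by (simp add: emeasure_space_1)
    next
      case (Suc k)
      have "(\<integral>\<^sup>+\<omega>\<in>D (Suc k). ennreal (V (n + Suc k) \<omega>) \<partial>M) + ennreal \<beta> * emeasure M (D k - D (Suc k))
          = (\<integral>\<^sup>+\<omega>. ennreal (V (n + Suc k) \<omega>) * indicator (D (Suc k)) \<omega>
              + ennreal \<beta> * indicator (D k - D (Suc k)) \<omega> \<partial>M)"
        by (simp add: nn_integral_add nn_integral_cmult)
      also have "\<dots> \<le> (\<integral>\<^sup>+\<omega>\<in>D k. ennreal (V (n + Suc k) \<omega>) \<partial>M)"
      proof (intro nn_integral_mono)
        fix \<omega> assume "\<omega> \<in> space M"
        show "ennreal (V (n + Suc k) \<omega>) * indicator (D (Suc k)) \<omega> + ennreal \<beta> * indicator (D k - D (Suc k)) \<omega>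
            \<le> ennreal (V (n + Suc k) \<omega>) * indicator (D k) \<omega>"
        \<comment> \<open>A path that leaves between these events does so at time
          \<open>n + Suc k\<close>, where its value is at least \<open>\<beta>\<close> and pays for
          the second term.\<close>
        proof (cases "\<omega> \<in> D k - D (Suc k)")
          case True
          then have "\<beta> \<le> V (n + Suc k) \<omega>"
            unfolding D_def by (auto simp: atLeastAtMostSuc_conv)
          then show ?thesis using True by (simp add: ennreal_leI)
        next
          case False
          then show ?thesis using D_mono[of k] by (auto simp: indicator_def)
        qed
      qed
      also have "\<dots> \<le> (\<integral>\<^sup>+\<omega>\<in>D k. ennreal (V (n + k) \<omega>) \<partial>M) + ennreal ((\<gamma> (n + k))\<^sup>2)"
        using one_step[OF D_F[of k]] by simp
      finally have 1: "(\<integral>\<^sup>+\<omega>\<in>D (Suc k). ennreal (V (n + Suc k) \<omega>) \<partial>M) + ennreal \<beta> * emeasure M (D k - D (Suc k))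
          \<le> (\<integral>\<^sup>+\<omega>\<in>D k. ennreal (V (n + k) \<omega>) \<partial>M) + ennreal ((\<gamma> (n + k))\<^sup>2)" .
      have "D 0 - D (Suc k) = (D 0 - D k) \<union> (D k - D (Suc k))"
        using D_mono[of k] D_anti[of 0 k] by auto
      then have "emeasure M (D 0 - D (Suc k)) = emeasure M (D 0 - D k) + emeasure M (D k - D (Suc k))"
        by (simp, subst plus_emeasure) (auto simp: Un_commute)
      then have "(\<integral>\<^sup>+\<omega>\<in>D (Suc k). ennreal (V (n + Suc k) \<omega>) \<partial>M) + ennreal \<beta> * emeasure M (D 0 - D (Suc k))
          = ((\<integral>\<^sup>+\<omega>\<in>D (Suc k). ennreal (V (n + Suc k) \<omega>) \<partial>M) + ennreal \<beta> * emeasure M (D k - D (Suc k)))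
            + ennreal \<beta> * emeasure M (D 0 - D k)"
        by (simp add: distrib_left ac_simps)
      also have "\<dots> \<le> ((\<integral>\<^sup>+\<omega>\<in>D k. ennreal (V (n + k) \<omega>) \<partial>M) + ennreal ((\<gamma> (n + k))\<^sup>2))
            + ennreal \<beta> * emeasure M (D 0 - D k)"
        by (intro add_mono 1 order_refl)
      also have "\<dots> = ((\<integral>\<^sup>+\<omega>\<in>D k. ennreal (V (n + k) \<omega>) \<partial>M) + ennreal \<beta> * emeasure M (D 0 - D k))
            + ennreal ((\<gamma> (k + n))\<^sup>2)"
        by (simp add: ac_simps)
      also have "\<dots> \<le> (ennreal e + ennreal (\<Sum>j<k. (\<gamma> (j + n))\<^sup>2)) + ennreal ((\<gamma> (k + n))\<^sup>2)"
        by (intro add_mono Suc.IH order_refl)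
      also have "\<dots> = ennreal e + ennreal (\<Sum>j<Suc k. (\<gamma> (j + n))\<^sup>2)"
        by (simp add: ennreal_plus sum_nonneg ac_simps)
      finally show ?case .
    qed
    define T where "T = (\<Sum>k. (\<gamma> (k + n))\<^sup>2)"
    have summ: "summable (\<lambda>k. (\<gamma> (k + n))\<^sup>2)"
      using summable_ignore_initial_segment[OF \<gamma>(3)] by simp
    have T: "0 \<le> T" "(\<Sum>j<k. (\<gamma> (j + n))\<^sup>2) \<le> T" for k
      unfolding T_def by (auto intro!: suminf_nonneg sum_le_suminf summ)
    have bound: "prob (D 0 - D k) \<le> (e + T) / \<beta>" for k
    proof -
      have "ennreal (\<beta> * prob (D 0 - D k)) = ennreal \<beta> * emeasure M (D 0 - D k)"
        using \<beta> by (simp add: emeasure_eq_measure ennreal_mult)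
      also have "\<dots> \<le> ennreal e + ennreal (\<Sum>j<k. (\<gamma> (j + n))\<^sup>2)"
        by (rule order_trans[OF _ stopped[of k]]) (simp add: add_increasing)
      also have "\<dots> \<le> ennreal (e + T)"
        using T that by (simp add: ennreal_plus ennreal_leI)
      finally have "\<beta> * prob (D 0 - D k) \<le> e + T"
        using T that by (subst (asm) ennreal_le_iff) auto
      then show ?thesis using \<beta> by (simp add: pos_le_divide_eq mult.commute)
    qed
    \<comment> \<open>Continuity from below removes the finite horizon.\<close>
    have "(\<lambda>k. prob (D 0 - D k)) \<longlonglongrightarrow> prob (\<Union>k. D 0 - D k)"
      by (rule finite_Lim_measure_incseq) (use D_anti in \<open>auto simp: incseq_def\<close>)
    then have "prob (\<Union>k. D 0 - D k) \<le> (e + T) / \<beta>"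
      by (rule LIMSEQ_le_const2) (use bound in auto)
    moreover have "{\<omega>\<in>space M. V n \<omega> < e \<and> (\<exists>k\<ge>n. \<beta> \<le> V k \<omega>)} \<subseteq> (\<Union>k. D 0 - D k)"
    proof safe
      fix \<omega> k assume "\<omega> \<in> space M" "V n \<omega> < e" "n \<le> k" "\<beta> \<le> V k \<omega>"
      \<comment> \<open>The assumption \<open>e \<le> \<beta>\<close> puts the path into
        \<open>D 0\<close>; reaching \<open>\<beta>\<close> at time \<open>k\<close> excludes it
        from \<open>D (k - n)\<close>.\<close>
      then have "\<omega> \<in> D 0 - D (k - n)"
        using that unfolding D_def by (auto simp: not_less intro!: bexI[of _ k])
      then show "\<omega> \<in> (\<Union>k. D 0 - D k)" by blast
    qed
    ultimately show ?thesis
      unfolding T_def by (rule order_trans[OF finite_measure_mono, rotated 2]) auto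
  qed

  have "AE \<omega> in M. \<not> (\<forall>n. \<exists>k\<ge>n. \<beta> \<le> V k \<omega>)" if \<beta>: "\<beta> > 0" for \<beta>
  proof -
    define S where "S = {\<omega>\<in>space M. \<forall>n. \<exists>k\<ge>n. \<beta> \<le> V k \<omega>}"
    have S[measurable]: "S \<in> sets M" unfolding S_def by measurable
    have "prob S \<le> 0"
    proof (rule field_le_epsilon)
      fix r :: real assume r: "r > 0"
      \<comment> \<open>The three parts are the probability of starting above \<open>e\<close>, the
        quotient \<open>e / \<beta>\<close>, and the tail of the squared steps divided by
        \<open>\<beta>\<close>. The minimum in \<open>e\<close> also ensures
        \<open>e \<le> \<beta>\<close>, as \<open>maximal\<close> demands.\<close>
      define \<rho> where "\<rho> = r / 3"
      define e where "e = min \<beta> (\<rho> * \<beta>)"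
      have \<rho>: "\<rho> > 0" and e: "0 < e" "e \<le> \<beta>" "e \<le> \<rho> * \<beta>"
        using r \<beta> by (auto simp: \<rho>_def e_def)
      obtain n0 where n0: "\<And>n. n \<ge> n0 \<Longrightarrow> norm (\<Sum>k. (\<gamma> (k + n))\<^sup>2) < \<rho> * \<beta>"
        using suminf_exist_split[OF _ \<gamma>(3), of "\<rho> * \<beta>"] \<rho> \<beta> by auto
      obtain n where n: "n \<ge> n0" "prob {\<omega>\<in>space M. e \<le> V n \<omega>} < \<rho>"
        using frequently_small[OF e(1) \<rho>] by blast
      have "S \<subseteq> {\<omega>\<in>space M. e \<le> V n \<omega>} \<union> {\<omega>\<in>space M. V n \<omega> < e \<and> (\<exists>k\<ge>n. \<beta> \<le> V k \<omega>)}"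
        by (auto simp: S_def not_less)
      then have "prob S \<le> prob ({\<omega>\<in>space M. e \<le> V n \<omega>} \<union> {\<omega>\<in>space M. V n \<omega> < e \<and> (\<exists>k\<ge>n. \<beta> \<le> V k \<omega>)})"
        by (intro finite_measure_mono) measurable
      also have "\<dots> \<le> prob {\<omega>\<in>space M. e \<le> V n \<omega>} + prob {\<omega>\<in>space M. V n \<omega> < e \<and> (\<exists>k\<ge>n. \<beta> \<le> V k \<omega>)}"
        by (intro measure_Un_le) measurable
      also have "\<dots> \<le> \<rho> + (e + (\<Sum>k. (\<gamma> (k + n))\<^sup>2)) / \<beta>"
        using n(2) maximal[OF e(1,2), of n] by simp
      also have "\<dots> \<le> \<rho> + (\<rho> * \<beta> + \<rho> * \<beta>) / \<beta>"
        using e n0[OF n(1)] \<beta> by (intro add_left_mono divide_right_mono add_mono) auto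
      also have "\<dots> = 0 + r"
        using \<beta> by (simp add: \<rho>_def field_simps)
      finally show "prob S \<le> 0 + r" .
    qed
    then have "emeasure M S = 0"
      by (simp add: emeasure_eq_measure measure_le_0_iff)
    then show ?thesis
      by (intro AE_I[of _ _ S]) (auto simp: S_def)
  qed
  \<comment> \<open>Countably many levels suffice, so the exceptional null sets can be
    united.\<close>
  then have "AE \<omega> in M. \<forall>i. \<not> (\<forall>n. \<exists>k\<ge>n. 1 / real (Suc i) \<le> V k \<omega>)"
    unfolding AE_all_countable by simp
  then show ?thesis
  proof eventually_elim
    case (elim \<omega>)
    show ?case
    proof (rule LIMSEQ_I)
      fix r :: real assume "r > 0"
      then obtain i where i: "1 / real (Suc i) < r"
        using nat_approx_posE by blast
      obtain n where "\<And>k. k \<ge> n \<Longrightarrow> V k \<omega> < 1 / real (Suc i)"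
        using elim by (meson not_le)
      then show "\<exists>n. \<forall>k\<ge>n. norm (V k \<omega> - 0) < r"
        using i V_nonneg by (intro exI[of _ n]) (auto intro: less_trans)
    qed
  qed
qed

section \<open>Independence of the past and the next sample\<close>

text \<open>Placing the start at index \<open>0\<close> yields one independent family, from which
  blocks of indices can be separated. In the product rule index \<open>0\<close> is split off; the
  intersection over the other indices is an event of the whole sample sequence.\<close>

lemma indep_vars_start:
  fixes Xs :: "nat \<Rightarrow> 'w \<Rightarrow> 'a::{real_inner, banach, second_countable_topology}"
  assumes M: "prob_space M"
    and ind: "prob_space.indep_vars M (\<lambda>_. borel) Xs {1..}"
    and start: "admissible_start M Xs Z\<^sub>0"
  shows "prob_space.indep_vars M (\<lambda>_. borel) (\<lambda>n. if n = 0 then Z\<^sub>0 else Xs n) UNIV"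
proof -
  interpret prob_space M by fact
  define Y where "Y n = (if n = 0 then Z\<^sub>0 else Xs n)" for n
  let ?P = "Pi\<^sub>M {1..} (\<lambda>_. borel) :: (nat \<Rightarrow> 'a) measure"
  let ?R = "\<lambda>\<omega>. \<lambda>n\<in>{1..}. Xs n \<omega>"
  have Xs: "Xs n \<in> borel_measurable M" if "n \<ge> 1" for n
    using ind that by (auto simp: indep_vars_def)
  have Z0: "Z\<^sub>0 \<in> borel_measurable M"
    and iset: "indep_set (sets (vimage_algebra (space M) Z\<^sub>0 borel)) (sets (vimage_algebra (space M) ?R ?P))"
    using start by (auto simp: admissible_start_def)
  have Y: "Y n \<in> borel_measurable M" for n
    using Xs[of n] Z0 by (simp add: Y_def)
  have "indep_vars (\<lambda>_. borel) Y UNIV"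
    unfolding indep_vars_def2
  proof (intro conjI ballI indep_setsI)
    fix A J assume J: "J \<noteq> {}" "J \<subseteq> UNIV" "finite J"
      and A: "\<forall>j\<in>J. A j \<in> {Y j -` B \<inter> space M |B. B \<in> sets borel}"
    obtain B where B: "\<And>j. j \<in> J \<Longrightarrow> B j \<in> sets borel \<and> A j = Y j -` B j \<inter> space M"
      using A by (auto dest!: bchoice)
    have tail: "prob (\<Inter>j\<in>L. A j) = (\<Prod>j\<in>L. prob (A j))" if L: "L \<noteq> {}" "L \<subseteq> J - {0}" for L
    proof -
      have "indep_sets (\<lambda>i. {Xs i -` B \<inter> space M |B. B \<in> sets borel}) {1..}"
        using ind by (simp add: indep_vars_def2)
      moreover have "A j \<in> {Xs j -` B \<inter> space M |B. B \<in> sets borel}" if "j \<in> L" for j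
      proof -
        have "j \<in> J" "j \<noteq> 0" using that L(2) by auto
        then show ?thesis using bspec[OF A, of j] by (simp add: Y_def)
      qed
      moreover have "L \<subseteq> {1..}" "finite L"
        using L J finite_subset[of L J] by (auto simp: Suc_le_eq)
      ultimately show ?thesis
        using L(1) by (intro indep_setsD) auto
    qed
    show "prob (\<Inter>j\<in>J. A j) = (\<Prod>j\<in>J. prob (A j))"
    proof (cases "0 \<in> J \<and> J - {0} \<noteq> {}")
      case True
      let ?L = "J - {0}"
      have fin: "finite ?L" using J by simp
      have "A 0 \<in> sets (vimage_algebra (space M) Z\<^sub>0 borel)"
        using B[of 0] True by (auto simp: Y_def intro!: in_vimage_algebra)
      moreover have "(\<Inter>j\<in>?L. A j) \<in> sets (vimage_algebra (space M) ?R ?P)"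
      proof -
        \<comment> \<open>A finite-dimensional cylinder in the sequence space, whose preimage is the
          joint event of the samples.\<close>
        define C where "C = {f \<in> space ?P. \<forall>j\<in>?L. f j \<in> B j}"
        have "C \<in> sets ?P"
          unfolding C_def
        proof (intro sets.sets_Collect_finite_All' fin)
          fix j assume "j \<in> ?L"
          then show "{f \<in> space ?P. f j \<in> B j} \<in> sets ?P"
            using B[of j] by (intro measurable_sets_Collect[OF measurable_component_singleton]) auto
        qed (use True in auto)
        moreover have "?R -` C \<inter> space M = (\<Inter>j\<in>?L. A j)"
          using True B by (auto simp: C_def space_PiM Y_def Suc_le_eq split: if_splits)
        ultimately show ?thesis
          using in_vimage_algebra[of C ?P ?R "space M"] by simp
      qed
      ultimately have "prob (A 0 \<inter> (\<Inter>j\<in>?L. A j)) = prob (A 0) * prob (\<Inter>j\<in>?L. A j)"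
        by (rule indep_setD[OF iset])
      also have "prob (\<Inter>j\<in>?L. A j) = (\<Prod>j\<in>?L. prob (A j))"
        using True by (intro tail) auto
      also have "A 0 \<inter> (\<Inter>j\<in>?L. A j) = (\<Inter>j\<in>J. A j)"
        using True by auto
      also have "prob (A 0) * (\<Prod>j\<in>?L. prob (A j)) = (\<Prod>j\<in>J. prob (A j))"
        using True J prod.remove[of J 0 "\<lambda>j. prob (A j)"] by simp
      finally show ?thesis .
    next
      case False
      show ?thesis
      proof (cases "0 \<in> J")
        case True
        then have "J = {0}" using False by auto
        then show ?thesis by simp
      next
        case False
        then show ?thesis using J by (intro tail) auto
      qed
    qed
  next
    show "random_variable borel (Y i)" for i by (rule Y)
    show "{Y i -` B \<inter> space M |B. B \<in> sets borel} \<subseteq> events" for i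
      using measurable_sets[OF Y] by blast
  qed
  then show ?thesis unfolding Y_def[abs_def] .
qed

text \<open>The product rule makes the joint law of \<open>S\<close> and \<open>Y\<close> a product
  measure, and Tonelli separates the integrals. It is stated on events so that \<open>S\<close> and
  \<open>Y\<close> may have different types; \<open>S\<close> will be the identity into the
  past.\<close>

lemma nn_integral_indep_pair:
  assumes M: "prob_space M"
    and S[measurable]: "S \<in> M \<rightarrow>\<^sub>M A" and Y[measurable]: "Y \<in> M \<rightarrow>\<^sub>M B"
    and ind: "\<And>C D. C \<in> sets A \<Longrightarrow> D \<in> sets B \<Longrightarrow>
      measure M ((S -` C \<inter> space M) \<inter> (Y -` D \<inter> space M))
        = measure M (S -` C \<inter> space M) * measure M (Y -` D \<inter> space M)"
    and f[measurable]: "case_prod f \<in> borel_measurable (A \<Otimes>\<^sub>M B)"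
  shows "(\<integral>\<^sup>+\<omega>. f (S \<omega>) (Y \<omega>) \<partial>M) = (\<integral>\<^sup>+\<omega>. (\<integral>\<^sup>+y. f (S \<omega>) y \<partial>distr M B Y) \<partial>M)"
proof -
  interpret prob_space M by fact
  interpret Q: prob_space "distr M B Y" by (rule prob_space_distr) simp
  interpret P: prob_space "distr M A S" by (rule prob_space_distr) simp
  have "distr M A S \<Otimes>\<^sub>M distr M B Y = distr M (A \<Otimes>\<^sub>M B) (\<lambda>\<omega>. (S \<omega>, Y \<omega>))"
  proof (rule pair_measure_eqI)
    fix C D assume CD: "C \<in> sets (distr M A S)" "D \<in> sets (distr M B Y)"
    then have [measurable]: "C \<in> sets A" "D \<in> sets B" by auto
    have "(\<lambda>\<omega>. (S \<omega>, Y \<omega>)) -` (C \<times> D) \<inter> space M = (S -` C \<inter> space M) \<inter> (Y -` D \<inter> space M)"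
      by auto
    then show "emeasure (distr M A S) C * emeasure (distr M B Y) D
        = emeasure (distr M (A \<Otimes>\<^sub>M B) (\<lambda>\<omega>. (S \<omega>, Y \<omega>))) (C \<times> D)"
      using ind[of C D] by (simp add: emeasure_distr emeasure_eq_measure ennreal_mult)
  qed (auto intro: P.sigma_finite_measure_axioms Q.sigma_finite_measure_axioms)
  note joint = this
  have "(\<integral>\<^sup>+\<omega>. f (S \<omega>) (Y \<omega>) \<partial>M) = (\<integral>\<^sup>+z. case_prod f z \<partial>distr M (A \<Otimes>\<^sub>M B) (\<lambda>\<omega>. (S \<omega>, Y \<omega>)))"
    by (simp add: nn_integral_distr)
  also have "\<dots> = (\<integral>\<^sup>+s. (\<integral>\<^sup>+y. f s y \<partial>distr M B Y) \<partial>distr M A S)"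
    unfolding joint[symmetric] by (subst Q.nn_integral_fst[symmetric]) auto
  also have "\<dots> = (\<integral>\<^sup>+\<omega>. (\<integral>\<^sup>+y. f (S \<omega>) y \<partial>distr M B Y) \<partial>M)"
    by (rule nn_integral_distr) auto
  finally show ?thesis .
qed

section \<open>Convergence of the stochastic gradient iterates\<close>

theorem theorem3p1:
  fixes N :: "'v measure" and M :: "'w measure"
    and X :: "'v \<Rightarrow> 'a::{real_inner, banach, second_countable_topology}"
    and Xs :: "nat \<Rightarrow> 'w \<Rightarrow> 'a" and Z\<^sub>0 :: "'w \<Rightarrow> 'a"
    and m :: 'a and \<gamma> :: "nat \<Rightarrow> real"
  assumes "prob_space N" and "X \<in> borel_measurable N"
    and "not_concentrated_on_line N X"
    and "is_geometric_median N X m"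
    and "mixture_condition N X m"
    and "\<And>n. \<gamma> n > 0"
    and "\<not> summable (\<lambda>n. \<gamma> (Suc n))"
    and "summable (\<lambda>n. (\<gamma> (Suc n))\<^sup>2)"
    and "prob_space M"
    and "independent_copies M Xs N X"
    and "admissible_start M Xs Z\<^sub>0"
  shows "AE \<omega> in M. (\<lambda>n. norm (sg_iterate \<gamma> Z\<^sub>0 Xs n \<omega> - m)) \<longlonglongrightarrow> 0"
proof -
  interpret prob_space M by fact
  note N = \<open>prob_space N\<close> and X[measurable] = \<open>X \<in> borel_measurable N\<close>
  have ind_Xs: "indep_vars (\<lambda>_. borel) Xs {1..}"
    and law: "\<And>n. n \<ge> 1 \<Longrightarrow> distr M borel (Xs n) = distr N borel X"
    using \<open>independent_copies M Xs N X\<close> by (auto simp: independent_copies_def)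
  define Y where "Y n = (if n = 0 then Z\<^sub>0 else Xs n)" for n
  have ind_Y: "indep_vars (\<lambda>_. borel) Y UNIV"
    using indep_vars_start[OF \<open>prob_space M\<close> ind_Xs \<open>admissible_start M Xs Z\<^sub>0\<close>]
    unfolding Y_def[abs_def] .
  have Y[measurable]: "Y n \<in> borel_measurable M" for n
    using ind_Y by (auto simp: indep_vars_def)
  \<comment> \<open>\<open>F n\<close> below is generated by the start and the first
    \<open>n\<close> samples, which together determine \<open>Z n\<close>.\<close>
  define R where "R n \<omega> = (\<lambda>i\<in>{..n}. Y i \<omega>)" for n \<omega>
  define P where "P n = (Pi\<^sub>M {..n} (\<lambda>_. borel) :: (nat \<Rightarrow> 'a) measure)" for n
  define F where "F n = vimage_algebra (space M) (R n) (P n)" for n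
  have R_space: "R n \<in> space M \<rightarrow> space (P n)" for n
    by (auto simp: R_def P_def space_PiM)
  have space_F[simp]: "space (F n) = space M" for n
    by (simp add: F_def)
  have R_measurable: "R n \<in> G \<rightarrow>\<^sub>M P n" if "\<And>i. i \<le> n \<Longrightarrow> Y i \<in> borel_measurable G" for n G
    unfolding R_def P_def using that by (intro measurable_restrict) auto
  have Y_F: "Y i \<in> borel_measurable (F n)" if "i \<le> n" for i n
  proof -
    have "(\<lambda>f. f i) \<in> borel_measurable (P n)"
      unfolding P_def using that by (intro measurable_component_singleton) simp
    from measurable_compose[OF measurable_vimage_algebra1[OF R_space] this]
    have "(\<lambda>\<omega>. R n \<omega> i) \<in> borel_measurable (F n)" by (simp add: F_def)
    then show ?thesis using that by (simp add: R_def)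
  qed
  have F_mono: "sets (F j) \<subseteq> sets (F k)" if "j \<le> k" for j k
    unfolding F_def[of j] using that by (intro sets_image_in_sets R_measurable Y_F) auto
  have F_sub: "subalgebra M (F n)" for n
    unfolding subalgebra_def
  proof
    show "sets (F n) \<subseteq> sets M"
      unfolding F_def by (intro sets_image_in_sets R_measurable Y) simp
  qed simp
  have id_F[measurable]: "(\<lambda>\<omega>. \<omega>) \<in> M \<rightarrow>\<^sub>M F n" for n
    using F_sub[of n] by (auto simp: subalgebra_def measurable_def)
  have F_indep: "prob (D \<inter> (Y (Suc n) -` B \<inter> space M)) = prob D * prob (Y (Suc n) -` B \<inter> space M)"
    if D: "D \<in> sets (F n)" and B: "B \<in> sets borel" for D B n
  proof -
    obtain C where C: "C \<in> sets (P n)" "D = R n -` C \<inter> space M"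
      using D unfolding F_def sets_vimage_algebra2[OF R_space] by blast
    let ?Q = "Pi\<^sub>M {Suc n} (\<lambda>_. borel) :: (nat \<Rightarrow> 'a) measure"
    \<comment> \<open>The next sample is written as a family with one entry, the form in which
      independence of disjoint index blocks is obtained.\<close>
    let ?T = "\<lambda>\<omega>. \<lambda>i\<in>{Suc n}. Y i \<omega>"
    define E where "E = {f \<in> space ?Q. f (Suc n) \<in> B}"
    have E: "E \<in> sets ?Q"
      unfolding E_def using B by (intro measurable_sets_Collect[OF measurable_component_singleton]) auto
    have "?T -` E \<inter> space M = Y (Suc n) -` B \<inter> space M"
      by (auto simp: E_def space_PiM)
    moreover have "indep_var (P n) (R n) ?Q ?T"
      using indep_var_restrict[OF ind_Y, of "{..n}" "{Suc n}"] by (simp add: P_def R_def[abs_def])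
    then have "prob ((\<lambda>\<omega>. (R n \<omega>, ?T \<omega>)) -` (C \<times> E) \<inter> space M)
        = prob (R n -` C \<inter> space M) * prob (?T -` E \<inter> space M)"
      by (rule indep_varD) (use C E in auto)
    moreover have "(\<lambda>\<omega>. (R n \<omega>, ?T \<omega>)) -` (C \<times> E) \<inter> space M = D \<inter> (?T -` E \<inter> space M)"
      using C by auto
    ultimately show ?thesis using C by simp
  qed
  define Z where "Z = sg_iterate \<gamma> Z\<^sub>0 Xs"
  \<comment> \<open>\<open>sgn 0 = 0\<close> expresses the convention that the iterate stays in
    place when it meets the new sample.\<close>
  have Z_Suc: "Z (Suc n) \<omega> = Z n \<omega> + \<gamma> n *\<^sub>R sgn (Y (Suc n) \<omega> - Z n \<omega>)" for n \<omega>
    by (simp add: Z_def Y_def sgn_div_norm)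
  have Z_F: "Z n \<in> borel_measurable (F n)" for n
  proof (induction n)
    case 0
    then show ?case using Y_F[of 0 0] by (simp add: Z_def Y_def)
  next
    case (Suc n)
    have [measurable]: "Z n \<in> borel_measurable (F (Suc n))"
      using Suc F_mono[of n "Suc n"] by (auto simp: measurable_def)
    have [measurable]: "Y (Suc n) \<in> borel_measurable (F (Suc n))"
      by (rule Y_F) simp
    have "(\<lambda>\<omega>. Z n \<omega> + \<gamma> n *\<^sub>R sgn (Y (Suc n) \<omega> - Z n \<omega>)) \<in> borel_measurable (F (Suc n))"
      unfolding sgn_div_norm by measurable
    then show ?case by (simp add: Z_Suc)
  qed
  have Z_M[measurable]: "Z n \<in> borel_measurable M" for n
    by (rule measurable_from_subalg[OF F_sub Z_F])
  define V where "V n \<omega> = (norm (Z n \<omega> - m))\<^sup>2" for n \<omega>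
  have "AE \<omega> in M. (\<lambda>n. V n \<omega>) \<longlonglongrightarrow> 0"
  proof (rule almost_supermartingale_tendsto_0[where F = F and \<gamma> = \<gamma>])
    show "V k \<in> borel_measurable (F k)" for k
      unfolding V_def using Z_F[of k] by measurable
    \<comment> \<open>The hypotheses sum from index \<open>1\<close>, the convergence lemma from
      \<open>0\<close>; one term does not affect summability.\<close>
    show "\<not> summable \<gamma>" "summable (\<lambda>k. (\<gamma> k)\<^sup>2)"
      using assms(7,8) summable_Suc_iff[of \<gamma>] summable_Suc_iff[of "\<lambda>k. (\<gamma> k)\<^sup>2"] by auto
    show "(\<integral>\<^sup>+\<omega>. ennreal (V 0 \<omega>) \<partial>M) < \<infinity>"
    proof -
      obtain K where "AE \<omega> in M. norm (Z\<^sub>0 \<omega>) \<le> K"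
        using \<open>admissible_start M Xs Z\<^sub>0\<close> by (auto simp: admissible_start_def)
      then have "AE \<omega> in M. ennreal (V 0 \<omega>) \<le> ennreal ((K + norm m)\<^sup>2)"
      proof eventually_elim
        case (elim \<omega>)
        have "norm (Z\<^sub>0 \<omega> - m) \<le> K + norm m"
          using norm_triangle_ineq4[of "Z\<^sub>0 \<omega>" m] elim by simp
        then show ?case
          by (auto simp: V_def Z_def intro!: ennreal_leI power_mono)
      qed
      then have "(\<integral>\<^sup>+\<omega>. ennreal (V 0 \<omega>) \<partial>M) \<le> (\<integral>\<^sup>+\<omega>. ennreal ((K + norm m)\<^sup>2) \<partial>M)"
        by (rule nn_integral_mono_AE)
      then show ?thesis by (simp add: emeasure_space_1 le_less_trans)
    qed
    fix \<epsilon> :: real assume "0 < \<epsilon>"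
    \<comment> \<open>\<open>V\<close> is a squared distance, so its level \<open>\<epsilon>\<close>
      corresponds to radius \<open>sqrt \<epsilon>\<close>.\<close>
    then have "0 < sqrt \<epsilon>" by simp
    then obtain \<delta> where \<delta>: "\<delta> > 0" and excess: "\<And>z. sqrt \<epsilon> \<le> norm (z - m) \<Longrightarrow>
        \<delta> \<le> (\<integral>v. norm (X v - z) - norm (X v - m) \<partial>N)"
      using geometric_median_excess[OF N X assms(3,4)] by blast
    have drift: "(\<integral>\<^sup>+v. ennreal ((norm (z + \<gamma> k *\<^sub>R sgn (X v - z) - m))\<^sup>2) \<partial>N)
          + ennreal (\<gamma> k * (2 * \<delta>)) * indicator {z. \<epsilon> \<le> (norm (z - m))\<^sup>2} z
        \<le> ennreal ((norm (z - m))\<^sup>2) + ennreal ((\<gamma> k)\<^sup>2)" for z k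
    proof (cases "\<epsilon> \<le> (norm (z - m))\<^sup>2")
      case True
      then have "sqrt \<epsilon> \<le> norm (z - m)" by (simp add: real_le_lsqrt)
      from normalized_step_contracts[OF N X _ excess[OF this], of "\<gamma> k"] assms(6)[of k] \<delta>
      show ?thesis using True by (simp add: mult_ac less_imp_le)
    next
      \<comment> \<open>Inside the ball the indicator is zero, and minimality of \<open>m\<close>
        gives the bound with excess \<open>0\<close>.\<close>
      case False
      then show ?thesis
        using normalized_step_contracts[OF N X _ geometric_median_minimal[OF N X assms(4)], of "\<gamma> k" z]
          assms(6)[of k] by (simp add: less_imp_le)
    qed
    show "\<exists>\<delta>>0. \<forall>k. \<forall>D\<in>sets (F k).
      (\<integral>\<^sup>+\<omega>\<in>D. ennreal (V (Suc k) \<omega>) \<partial>M)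
        + ennreal (\<gamma> k * \<delta>) * emeasure M {\<omega>\<in>D. \<epsilon> \<le> V k \<omega>}
      \<le> (\<integral>\<^sup>+\<omega>\<in>D. ennreal (V k \<omega>) \<partial>M) + ennreal ((\<gamma> k)\<^sup>2)"
    proof (intro exI[of _ "2 * \<delta>"] conjI allI ballI)
      fix k D assume D: "D \<in> sets (F k)"
      then have D_M[measurable]: "D \<in> sets M"
        using F_sub[of k] by (auto simp: subalgebra_def)
      define h where "h z x = ennreal ((norm (z + \<gamma> k *\<^sub>R sgn (x - z) - m))\<^sup>2)" for z x :: 'a
      have h[measurable]: "case_prod h \<in> borel_measurable (borel \<Otimes>\<^sub>M borel)"
        unfolding h_def sgn_div_norm by measurable
      have "(\<integral>\<^sup>+\<omega>\<in>D. ennreal (V (Suc k) \<omega>) \<partial>M)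
          = (\<integral>\<^sup>+\<omega>. h (Z k \<omega>) (Y (Suc k) \<omega>) * indicator D \<omega> \<partial>M)"
        by (simp add: V_def Z_Suc h_def)
      also have "\<dots> = (\<integral>\<^sup>+\<omega>. (\<integral>\<^sup>+x. h (Z k \<omega>) x * indicator D \<omega> \<partial>distr M borel (Y (Suc k))) \<partial>M)"
      \<comment> \<open>Taking \<open>S\<close> to be the identity into \<open>F k\<close> treats
        \<open>Z k\<close> and \<open>D\<close> together as functions of the past.\<close>
      proof (rule nn_integral_indep_pair[where S = "\<lambda>\<omega>. \<omega>" and A = "F k"])
        show "(\<lambda>(\<omega>, x). h (Z k \<omega>) x * indicator D \<omega>) \<in> borel_measurable (F k \<Otimes>\<^sub>M borel)"
          using D Z_F[of k] by measurable
        fix C B assume C: "C \<in> sets (F k)" and B: "B \<in> sets (borel :: 'a measure)"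
        have "C \<subseteq> space M" using sets.sets_into_space[OF C] by simp
        then show "prob (((\<lambda>\<omega>. \<omega>) -` C \<inter> space M) \<inter> (Y (Suc k) -` B \<inter> space M))
            = prob ((\<lambda>\<omega>. \<omega>) -` C \<inter> space M) * prob (Y (Suc k) -` B \<inter> space M)"
          using F_indep[OF C B] by (simp add: Int_absorb2)
      qed (use \<open>prob_space M\<close> in auto)
      also have "\<dots> = (\<integral>\<^sup>+\<omega>. (\<integral>\<^sup>+v. h (Z k \<omega>) (X v) \<partial>N) * indicator D \<omega> \<partial>M)"
      proof (intro nn_integral_cong)
        fix \<omega>
        have "distr M borel (Y (Suc k)) = distr N borel X"
          using law[of "Suc k"] by (simp add: Y_def)
        then show "(\<integral>\<^sup>+x. h (Z k \<omega>) x * indicator D \<omega> \<partial>distr M borel (Y (Suc k)))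
            = (\<integral>\<^sup>+v. h (Z k \<omega>) (X v) \<partial>N) * indicator D \<omega>"
          by (simp add: nn_integral_distr nn_integral_multc)
      qed
      finally have next_eq: "(\<integral>\<^sup>+\<omega>\<in>D. ennreal (V (Suc k) \<omega>) \<partial>M)
          = (\<integral>\<^sup>+\<omega>. (\<integral>\<^sup>+v. h (Z k \<omega>) (X v) \<partial>N) * indicator D \<omega> \<partial>M)" .
      interpret N: prob_space N by fact
      let ?G = "\<lambda>\<omega>. ennreal (\<gamma> k * (2 * \<delta>)) * indicator {\<omega>\<in>D. \<epsilon> \<le> V k \<omega>} \<omega>"
      have V_M[measurable]: "V k \<in> borel_measurable M" unfolding V_def by measurable
      have E[measurable]: "{\<omega>\<in>D. \<epsilon> \<le> V k \<omega>} \<in> sets M"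
      proof -
        have "{\<omega>\<in>D. \<epsilon> \<le> V k \<omega>} = D \<inter> {\<omega>\<in>space M. \<epsilon> \<le> V k \<omega>}"
          using sets.sets_into_space[OF D_M] by auto
        then show ?thesis by simp
      qed
      have "(\<integral>\<^sup>+\<omega>\<in>D. ennreal (V (Suc k) \<omega>) \<partial>M) + ennreal (\<gamma> k * (2 * \<delta>)) * emeasure M {\<omega>\<in>D. \<epsilon> \<le> V k \<omega>}
          = (\<integral>\<^sup>+\<omega>. (\<integral>\<^sup>+v. h (Z k \<omega>) (X v) \<partial>N) * indicator D \<omega> + ?G \<omega> \<partial>M)"
        unfolding next_eq by (simp add: nn_integral_add nn_integral_cmult)
      also have "\<dots> \<le> (\<integral>\<^sup>+\<omega>. ennreal (V k \<omega>) * indicator D \<omega> + ennreal ((\<gamma> k)\<^sup>2) \<partial>M)"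
      proof (intro nn_integral_mono)
        fix \<omega>
        show "(\<integral>\<^sup>+v. h (Z k \<omega>) (X v) \<partial>N) * indicator D \<omega> + ?G \<omega>
            \<le> ennreal (V k \<omega>) * indicator D \<omega> + ennreal ((\<gamma> k)\<^sup>2)"
          \<comment> \<open>Outside \<open>D\<close> the left side vanishes, so the squared step may
            be added on the whole space, where it integrates to itself.\<close>
          using drift[of "Z k \<omega>" k] by (cases "\<omega> \<in> D") (auto simp: h_def V_def indicator_def)
      qed
      also have "\<dots> = (\<integral>\<^sup>+\<omega>\<in>D. ennreal (V k \<omega>) \<partial>M) + ennreal ((\<gamma> k)\<^sup>2)"
        by (simp add: nn_integral_add emeasure_space_1)
      finally show "(\<integral>\<^sup>+\<omega>\<in>D. ennreal (V (Suc k) \<omega>) \<partial>M)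
          + ennreal (\<gamma> k * (2 * \<delta>)) * emeasure M {\<omega>\<in>D. \<epsilon> \<le> V k \<omega>}
        \<le> (\<integral>\<^sup>+\<omega>\<in>D. ennreal (V k \<omega>) \<partial>M) + ennreal ((\<gamma> k)\<^sup>2)" .
    qed (use \<delta> in simp)
  qed (use \<open>prob_space M\<close> F_sub F_mono assms(6) in \<open>auto simp: V_def\<close>)
  then show ?thesis
  proof eventually_elim
    case (elim \<omega>)
    then have "(\<lambda>n. sqrt (V n \<omega>)) \<longlonglongrightarrow> sqrt 0" by (rule tendsto_real_sqrt)
    then show ?case by (simp add: V_def Z_def)
  qed
qed

end
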